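(* Let $T>0$, $v^0\in L^2_\sigma(\Omega)$, $f\in L^2_{loc}([0,\infty);L^2(\Omega)^3)$, and let $h>0$, $\tau>0$. The discrete problem described in the context is uniquely solvable (i.e. it determines unique functions $u^n,u^{n+\frac12}:\Omega_h\to\mathbb R^3$, $n=0,1,\dots,T_\tau$), and the following estimates hold for $n=0,1,\dots,T_\tau-1$: $$\|u^{n+\frac12}\|_{\Omega_h}\le\|u^n\|_{\Omega_h}+\|f^{n+1}\|_{\Omega_h}\tau,$$ $$\|u^{n+1}\|_{\Omega_h}\le\|u^0\|_{\Omega_h}+\sum_{m=0}^{T_\tau-1}\|f^{m+1}\|_{\Omega_h}\tau\le\|v^0\|_{L^2(\Omega)^3}+\sqrt T\,\|f\|_{L^2([0,T];L^2(\Omega)^3)},$$ $$\|u^{n+1}\|_{\Omega_h}^2\le\|u^0\|_{\Omega_h}^2-\sum_{m=0}^n\Big(\sum_{j=1}^3\|D_j^+u^{m+\frac12}\|_{\Omega_h}^2\Big)\tau+2\sum_{m=0}^n\|u^m\|_{\Omega_h}\|f^{m+1}\|_{\Omega_h}\tau+\sum_{m=0}^n\|f^{m+1}\|_{\Omega_h}^2\tau^2.$$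
   Context: **Domain and function spaces.** $\Omega\subset\mathbb R^3$ is a bounded connected open set with Lipschitz boundary. $L^2_\sigma(\Omega)$ is the closure in $L^2(\Omega)^3$ of the set of compactly supported $C^\infty$ divergence-free vector fields on $\Omega$. **Grid.** For $h>0$ let $h\mathbb Z^3=\{(hz_1,hz_2,hz_3): z_i\in\mathbb Z\}$; $e^1,e^2,e^3$ is the standard basis of $\mathbb R^3$. For $B\subset h\mathbb Z^3$, $\partial B:=\{x\in B:\{x\pm he^i: i=1,2,3\}\not\subset B\}$. $C_h(x):=\prod_{i=1}^3[x_i-\frac h2,x_i+\frac h2)$, $\Omega_h:=\{x\in\Omega\cap h\mathbb Z^3: C_{4h}(x)\subset\Omega\}$. Functions on $\Omega_h$ are always extended by $0$ outside $\Omega_h$, and $D_i^+\phi(x)=\frac{\phi(x+he^i)-\phi(x)}h$, $D_i^-\phi(x)=\frac{\phi(x)-\phi(x-he^i)}h$, $D_i^2\phi(x)=\frac{\phi(x+he^i)+\phi(x-he^i)-2\phi(x)}{h^2}$, $\mathcal D\phi=(D_1^+\phi,D_2^+\phi,D_3^+\phi)$, $\mathcal D\cdot w=\sum_{i=1}^3D_i^-w_i$. For $u,w$ on $\Omega_h$: $(u,w)_{\Omega_h}:=\sum_{x\in\Omega_h}u(x)\cdot w(x)h^3$, $\|u\|_{\Omega_h}:=\sqrt{(u,u)_{\Omega_h}}$. **Discrete Helmholtz-Hodge operator $P_h$.** For $u:\Omega_h\to\mathbb R^3$ there are unique $w:\Omega_h\to\mathbb R^3$, $\phi:\Omega_h\to\mathbb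 R$ with $\mathcal D\cdot w=0$ and $w+\mathcal D\phi=u$ on $\Omega_h\setminus\partial\Omega_h$, and $w=0$, $\phi=0$ on $\partial\Omega_h$; set $P_hu:=w$. **Discrete problem.** Let $T_\tau$ be the integer with $T\in[\tau T_\tau,\tau T_\tau+\tau)$. Put $\tilde u^0(x)=h^{-3}\int_{C_h(x)}v^0(y)\,dy$ for $x\in\Omega_h\setminus\partial\Omega_h$, $\tilde u^0=0$ on $\partial\Omega_h$, and $f^{n+1}(x)=\tau^{-1}h^{-3}\int_{\tau n}^{\tau(n+1)}\int_{C_h(x)}f(t,y)\,dydt$ for $x\in\Omega_h$, $n=0,\dots,T_\tau$. The discrete problem for $u^n,u^{n+\frac12}:\Omega_h\to\mathbb R^3$, $n=0,\dots,T_\tau$, is the recurrence: $u^0=P_h\tilde u^0$; $$\frac{u_i^{n+\frac12}(x)-u_i^n(x)}\tau=-\sum_{j=1}^3\frac{u_j^n(x-he^j)D_j^+u_i^{n+\frac12}(x-he^j)+u_j^n(x)D_j^+u_i^{n+\frac12}(x)}2+\sum_{j=1}^3D_j^2u_i^{n+\frac12}(x)+f_i^{n+1}(x)$$ for $x\in\Omega_h\setminus\partial\Omega_h$, $i=1,2,3$; $u^{n+\frac12}=0$ on $\partial\Omega_h$; $u^{n+1}=P_hu^{n+\frac12}$. *)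

theory Defs
  imports "HOL-Analysis.Analysis"
begin

type_synonym vec3 = "real^3"

section \<open>Domain and function spaces\<close>

text \<open>Near every boundary point the domain is, after an orthogonal change of coordinates, the
  strict epigraph of a Lipschitz function of the first two coordinates.\<close>

definition lipschitz_boundary :: "vec3 set \<Rightarrow> bool" where
  "lipschitz_boundary \<Omega> \<longleftrightarrow>
    (\<forall>p\<in>frontier \<Omega>. \<exists>r>0. \<exists>Q :: vec3 \<Rightarrow> vec3. \<exists>\<gamma> :: real^2 \<Rightarrow> real. \<exists>L.
       orthogonal_transformation Q \<and> L-lipschitz_on UNIV \<gamma> \<and>
       \<Omega> \<inter> ball p r = {x \<in> ball p r. \<gamma> (vector [Q x $ 1, Q x $ 2]) < Q x $ 3})"

text \<open>Elements of Lebesgue spaces are represented by functions; they are not identified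
  almost everywhere.\<close>

definition L2 :: "vec3 set \<Rightarrow> (vec3 \<Rightarrow> vec3) set" where
  "L2 \<Omega> = {v. v \<in> borel_measurable (lebesgue_on \<Omega>) \<and>
              integrable (lebesgue_on \<Omega>) (\<lambda>x. (norm (v x))\<^sup>2)}"

definition L2_norm :: "vec3 set \<Rightarrow> (vec3 \<Rightarrow> vec3) \<Rightarrow> real" where
  "L2_norm \<Omega> v = sqrt (\<integral>x. (norm (v x))\<^sup>2 \<partial>lebesgue_on \<Omega>)"

definition partial_deriv :: "3 \<Rightarrow> (vec3 \<Rightarrow> vec3) \<Rightarrow> vec3 \<Rightarrow> vec3" where
  "partial_deriv i \<phi> x = frechet_derivative \<phi> (at x) (axis i 1)"

primrec C_k :: "nat \<Rightarrow> (vec3 \<Rightarrow> vec3) \<Rightarrow> bool" where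
  "C_k 0 \<phi> \<longleftrightarrow> continuous_on UNIV \<phi>"
| "C_k (Suc k) \<phi> \<longleftrightarrow> (\<forall>x. \<phi> differentiable (at x)) \<and> (\<forall>i. C_k k (partial_deriv i \<phi>))"

text \<open>Compactly supported fields on \<open>\<Omega>\<close> are represented by their extension by zero.\<close>

definition solenoidal_test_fields :: "vec3 set \<Rightarrow> (vec3 \<Rightarrow> vec3) set" where
  "solenoidal_test_fields \<Omega> =
    {\<phi>. (\<forall>k. C_k k \<phi>) \<and>
         compact (closure {x. \<phi> x \<noteq> 0}) \<and> closure {x. \<phi> x \<noteq> 0} \<subseteq> \<Omega> \<and>
         (\<forall>x. (\<Sum>i\<in>UNIV. partial_deriv i \<phi> x $ i) = 0)}"

definition L2_sigma :: "vec3 set \<Rightarrow> (vec3 \<Rightarrow> vec3) set" where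
  "L2_sigma \<Omega> =
    {v \<in> L2 \<Omega>. \<forall>\<epsilon>>0. \<exists>\<phi>\<in>solenoidal_test_fields \<Omega>. L2_norm \<Omega> (\<lambda>x. v x - \<phi> x) < \<epsilon>}"

text \<open>The Bochner space \<open>L\<^sup>2\<^sub>l\<^sub>o\<^sub>c([0,\<infinity>); L\<^sup>2(\<Omega>)\<^sup>3)\<close>: \<open>f\<close> takes values in \<open>L\<^sup>2\<close>, is strongly measurable
  (an almost everywhere \<open>L\<^sup>2\<close>-limit of simple functions), and \<open>t \<mapsto> \<parallel>f t\<parallel>\<^sup>2\<close> is integrable on
  every bounded interval.\<close>

definition L2_loc_time :: "vec3 set \<Rightarrow> (real \<Rightarrow> vec3 \<Rightarrow> vec3) set" where
  "L2_loc_time \<Omega> =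
    {f. (AE t in lebesgue_on {0..}. f t \<in> L2 \<Omega>) \<and>
        (\<exists>s :: nat \<Rightarrow> real \<Rightarrow> vec3 \<Rightarrow> vec3.
           (\<forall>k. simple_function (lebesgue_on {0..}) (s k) \<and> (\<forall>t\<ge>0. s k t \<in> L2 \<Omega>)) \<and>
           (AE t in lebesgue_on {0..}. (\<lambda>k. L2_norm \<Omega> (\<lambda>y. s k t y - f t y)) \<longlonglongrightarrow> 0)) \<and>
        (\<forall>R>0. integrable (lebesgue_on {0..R}) (\<lambda>t. (L2_norm \<Omega> (f t))\<^sup>2))}"

definition L2_time_norm :: "real \<Rightarrow> vec3 set \<Rightarrow> (real \<Rightarrow> vec3 \<Rightarrow> vec3) \<Rightarrow> real" where
  "L2_time_norm T \<Omega> f = sqrt (\<integral>t. (L2_norm \<Omega> (f t))\<^sup>2 \<partial>lebesgue_on {0..T})"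

section \<open>Grid\<close>

definition grid :: "real \<Rightarrow> vec3 set" where
  "grid h = {x. \<forall>i. \<exists>z::int. x $ i = h * of_int z}"

definition grid_boundary :: "real \<Rightarrow> vec3 set \<Rightarrow> vec3 set" where
  "grid_boundary h B =
    {x \<in> B. \<not> (\<Union>i. {x + h *\<^sub>R axis i 1, x - h *\<^sub>R axis i 1}) \<subseteq> B}"

definition cube :: "real \<Rightarrow> vec3 \<Rightarrow> vec3 set" where
  "cube h x = {y. \<forall>i. x $ i - h / 2 \<le> y $ i \<and> y $ i < x $ i + h / 2}"

definition grid_dom :: "real \<Rightarrow> vec3 set \<Rightarrow> vec3 set" where
  "grid_dom h \<Omega> = {x \<in> \<Omega> \<inter> grid h. cube (4 * h) x \<subseteq> \<Omega>}"

definition grid_int :: "real \<Rightarrow> vec3 set \<Rightarrow> vec3 set" where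
  "grid_int h \<Omega> = grid_dom h \<Omega> - grid_boundary h (grid_dom h \<Omega>)"

text \<open>Functions on \<open>\<Omega>\<^sub>h\<close> are represented by their extension by zero.\<close>

definition grid_funs :: "real \<Rightarrow> vec3 set \<Rightarrow> (vec3 \<Rightarrow> 'b::zero) set" where
  "grid_funs h \<Omega> = {\<phi>. \<forall>x. x \<notin> grid_dom h \<Omega> \<longrightarrow> \<phi> x = 0}"

definition D_plus :: "real \<Rightarrow> 3 \<Rightarrow> (vec3 \<Rightarrow> 'b::real_vector) \<Rightarrow> vec3 \<Rightarrow> 'b" where
  "D_plus h i \<phi> x = (\<phi> (x + h *\<^sub>R axis i 1) - \<phi> x) /\<^sub>R h"

definition D_minus :: "real \<Rightarrow> 3 \<Rightarrow> (vec3 \<Rightarrow> 'b::real_vector) \<Rightarrow> vec3 \<Rightarrow> 'b" where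
  "D_minus h i \<phi> x = (\<phi> x - \<phi> (x - h *\<^sub>R axis i 1)) /\<^sub>R h"

definition D_sq :: "real \<Rightarrow> 3 \<Rightarrow> (vec3 \<Rightarrow> 'b::real_vector) \<Rightarrow> vec3 \<Rightarrow> 'b" where
  "D_sq h i \<phi> x =
    (\<phi> (x + h *\<^sub>R axis i 1) + \<phi> (x - h *\<^sub>R axis i 1) - 2 *\<^sub>R \<phi> x) /\<^sub>R h\<^sup>2"

definition grid_grad :: "real \<Rightarrow> (vec3 \<Rightarrow> real) \<Rightarrow> vec3 \<Rightarrow> vec3" where
  "grid_grad h \<phi> x = (\<chi> i. D_plus h i \<phi> x)"

definition grid_div :: "real \<Rightarrow> (vec3 \<Rightarrow> vec3) \<Rightarrow> vec3 \<Rightarrow> real" where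
  "grid_div h w x = (\<Sum>i\<in>UNIV. D_minus h i (\<lambda>y. w y $ i) x)"

definition grid_inner :: "real \<Rightarrow> vec3 set \<Rightarrow> (vec3 \<Rightarrow> vec3) \<Rightarrow> (vec3 \<Rightarrow> vec3) \<Rightarrow> real" where
  "grid_inner h \<Omega> u w = (\<Sum>x\<in>grid_dom h \<Omega>. (u x \<bullet> w x) * h ^ 3)"

definition grid_norm :: "real \<Rightarrow> vec3 set \<Rightarrow> (vec3 \<Rightarrow> vec3) \<Rightarrow> real" where
  "grid_norm h \<Omega> u = sqrt (grid_inner h \<Omega> u u)"

section \<open>Discrete Helmholtz-Hodge operator\<close>

definition helmholtz_hodge ::
  "real \<Rightarrow> vec3 set \<Rightarrow> (vec3 \<Rightarrow> vec3) \<Rightarrow> (vec3 \<Rightarrow> vec3) \<Rightarrow> (vec3 \<Rightarrow> real) \<Rightarrow> bool" where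
  "helmholtz_hodge h \<Omega> u w \<phi> \<longleftrightarrow>
     w \<in> grid_funs h \<Omega> \<and> \<phi> \<in> grid_funs h \<Omega> \<and>
     (\<forall>x\<in>grid_int h \<Omega>. grid_div h w x = 0 \<and> w x + grid_grad h \<phi> x = u x) \<and>
     (\<forall>x\<in>grid_boundary h (grid_dom h \<Omega>). w x = 0 \<and> \<phi> x = 0)"

definition P_h :: "real \<Rightarrow> vec3 set \<Rightarrow> (vec3 \<Rightarrow> vec3) \<Rightarrow> vec3 \<Rightarrow> vec3" where
  "P_h h \<Omega> u = (THE w. \<exists>\<phi>. helmholtz_hodge h \<Omega> u w \<phi>)"

section \<open>Discrete problem\<close>

definition init_avg :: "real \<Rightarrow> vec3 set \<Rightarrow> (vec3 \<Rightarrow> vec3) \<Rightarrow> vec3 \<Rightarrow> vec3" where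
  "init_avg h \<Omega> v0 x =
    (if x \<in> grid_int h \<Omega> then (\<integral>y. v0 y \<partial>lebesgue_on (cube h x)) /\<^sub>R h ^ 3 else 0)"

text \<open>Index shift: \<open>force_avg h \<tau> \<Omega> f n\<close> is \<open>f\<^sup>n\<^sup>+\<^sup>1\<close>, the average over \<open>[\<tau>n, \<tau>(n+1)]\<close>.\<close>

definition force_avg ::
  "real \<Rightarrow> real \<Rightarrow> vec3 set \<Rightarrow> (real \<Rightarrow> vec3 \<Rightarrow> vec3) \<Rightarrow> nat \<Rightarrow> vec3 \<Rightarrow> vec3" where
  "force_avg h \<tau> \<Omega> f n x =
    (if x \<in> grid_dom h \<Omega>
     then (\<integral>t. (\<integral>y. f t y \<partial>lebesgue_on (cube h x))
             \<partial>lebesgue_on {\<tau> * real n .. \<tau> * (real n + 1)}) /\<^sub>R (\<tau> * h ^ 3)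
     else 0)"

definition momentum_eq ::
  "real \<Rightarrow> real \<Rightarrow> vec3 set \<Rightarrow> (vec3 \<Rightarrow> vec3) \<Rightarrow> (vec3 \<Rightarrow> vec3) \<Rightarrow> (vec3 \<Rightarrow> vec3) \<Rightarrow> bool" where
  "momentum_eq h \<tau> \<Omega> u w g \<longleftrightarrow>
    (\<forall>x\<in>grid_int h \<Omega>. \<forall>i.
       (w x $ i - u x $ i) / \<tau> =
         - (\<Sum>j\<in>UNIV.
              (u (x - h *\<^sub>R axis j 1) $ j * D_plus h j (\<lambda>y. w y $ i) (x - h *\<^sub>R axis j 1)
               + u x $ j * D_plus h j (\<lambda>y. w y $ i) x) / 2)
         + (\<Sum>j\<in>UNIV. D_sq h j (\<lambda>y. w y $ i) x)
         + g x $ i)"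

text \<open>\<open>u n\<close> and \<open>uh n\<close> stand for \<open>u\<^sup>n\<close> and the intermediate \<open>u\<close> at the half step \<open>n + 1/2\<close>, for
  \<open>0 \<le> n \<le> N\<close>. The extensional function space only fixes the irrelevant values at \<open>n > N\<close>,
  so that unique solvability can be expressed by \<open>\<exists>!\<close>.\<close>

definition discrete_solution ::
  "real \<Rightarrow> real \<Rightarrow> vec3 set \<Rightarrow> (vec3 \<Rightarrow> vec3) \<Rightarrow> (real \<Rightarrow> vec3 \<Rightarrow> vec3) \<Rightarrow> nat
    \<Rightarrow> (nat \<Rightarrow> vec3 \<Rightarrow> vec3) \<Rightarrow> (nat \<Rightarrow> vec3 \<Rightarrow> vec3) \<Rightarrow> bool" where
  "discrete_solution h \<tau> \<Omega> v0 f N u uh \<longleftrightarrow>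
     u \<in> {0..N} \<rightarrow>\<^sub>E grid_funs h \<Omega> \<and> uh \<in> {0..N} \<rightarrow>\<^sub>E grid_funs h \<Omega> \<and>
     u 0 = P_h h \<Omega> (init_avg h \<Omega> v0) \<and>
     (\<forall>n\<le>N. momentum_eq h \<tau> \<Omega> (u n) (uh n) (force_avg h \<tau> \<Omega> f n) \<and>
            (\<forall>x\<in>grid_boundary h (grid_dom h \<Omega>). uh n x = 0)) \<and>
     (\<forall>n<N. u (n + 1) = P_h h \<Omega> (uh n))"

end

theory Submission
  imports Defs
begin

text \<open>Each step of the scheme is a square linear system on the finitely many interior grid points, so
  uniqueness implies existence. For \<open>P\<^sub>h\<close> the system is the discrete Poisson equation for \<open>\<phi>\<close>, and
  summation by parts makes \<open>w\<close> and \<open>\<D>\<phi>\<close> orthogonal, so \<open>P\<^sub>h\<close> is a contraction. The momentum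
  equation decouples into one scalar equation for each velocity component; since \<open>u\<^sup>n\<close> is discretely
  divergence free, the convection term is skew-symmetric and drops out when testing with the solution.
  This gives injectivity and the energy identity
  \<open>\<parallel>w\<parallel>\<^sup>2 + \<tau> \<Sum>\<^sub>j \<parallel>D\<^sub>j\<^sup>+ w\<parallel>\<^sup>2 = (u\<^sup>n + \<tau> f\<^sup>n\<^sup>+\<^sup>1, w)\<close> for the half step \<open>w\<close>,
  whose right-hand side is at most \<open>(\<parallel>u\<^sup>n\<parallel> + \<tau> \<parallel>f\<^sup>n\<^sup>+\<^sup>1\<parallel>) \<parallel>w\<parallel>\<close>. The bounds by the data follow from the
  Cauchy-Schwarz inequality on the disjoint cubes \<open>C\<^sub>h(x) \<subseteq> \<Omega>\<close> and on the time intervals.\<close>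

section \<open>Square linear systems\<close>

text \<open>Gaussian elimination, by induction on the rows. If the new row is not zero on
  \<open>C\<close>, a pivot column is eliminated from the other rows; one row and one column
  disappear, so the strict inequality of cardinalities survives.\<close>

lemma underdetermined_homogeneous_system:
  fixes A :: "'r \<Rightarrow> 'c \<Rightarrow> real"
  assumes "finite R" "finite C" "card R < card C"
  shows "\<exists>z. (\<exists>y\<in>C. z y \<noteq> 0) \<and> (\<forall>r\<in>R. (\<Sum>y\<in>C. A r y * z y) = 0)"
  using assms
proof (induction R arbitrary: A C rule: finite_induct)
  case empty
  then have "C \<noteq> {}" by auto
  then show ?case by (intro exI[of _ "\<lambda>_. 1"]) auto
next
  case (insert r R)
  show ?case
  proof (cases "\<forall>y\<in>C. A r y = 0")
    case True
    have "card R < card C" using insert by auto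
    from insert.IH[OF insert.prems(1) this, of A] True show ?thesis by auto
  next
    case False
    then obtain p where p: "p \<in> C" "A r p \<noteq> 0" by auto
    \<comment> \<open>Row \<open>q\<close> minus the multiple \<open>A q p / A r p\<close> of row
      \<open>r\<close>; its entry in the pivot column \<open>p\<close> is zero.\<close>
    define A' where "A' q y = A q y - A q p * A r y / A r p" for q y
    have "card R < card (C - {p})" using insert p by auto
    from insert.IH[OF _ this, of A'] insert.prems obtain z where
      z: "\<exists>y\<in>C - {p}. z y \<noteq> 0" "\<And>q. q \<in> R \<Longrightarrow> (\<Sum>y\<in>C - {p}. A' q y * z y) = 0"
      by auto
    define s where "s = (\<Sum>y\<in>C - {p}. A r y * z y)"
    \<comment> \<open>The value at the pivot is obtained by solving row \<open>r\<close> for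
      it.\<close>
    define z' where "z' = z(p := - s / A r p)"
    have split: "(\<Sum>y\<in>C. A q y * z' y) = (\<Sum>y\<in>C - {p}. A q y * z y) - A q p * s / A r p" for q
    proof -
      have "(\<Sum>y\<in>C. A q y * z' y) = A q p * z' p + (\<Sum>y\<in>C - {p}. A q y * z' y)"
        using p insert.prems by (simp add: sum.remove)
      also have "(\<Sum>y\<in>C - {p}. A q y * z' y) = (\<Sum>y\<in>C - {p}. A q y * z y)"
        by (intro sum.cong) (auto simp: z'_def)
      finally show ?thesis by (simp add: z'_def)
    qed
    have "(\<Sum>y\<in>C. A q y * z' y) = 0" if "q \<in> R" for q
    proof -
      have "(\<Sum>y\<in>C - {p}. A' q y * z y) = (\<Sum>y\<in>C - {p}. A q y * z y) - A q p * s / A r p"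
        unfolding A'_def s_def
        by (simp add: sum_subtractf sum_distrib_left sum_divide_distrib left_diff_distrib mult.assoc)
      then show ?thesis using split z(2)[OF that] by simp
    qed
    moreover have "(\<Sum>y\<in>C. A r y * z' y) = 0" using split[of r] p by (simp add: s_def)
    moreover have "\<exists>y\<in>C. z' y \<noteq> 0" using z(1) by (auto simp: z'_def)
    ultimately show ?thesis by auto
  qed
qed

text \<open>The right-hand side \<open>b\<close> is treated as one more column.\<close>

lemma injective_system_solvable:
  fixes A :: "'a \<Rightarrow> 'a \<Rightarrow> real"
  assumes "finite S"
    and inj: "\<And>z. (\<And>x. x \<in> S \<Longrightarrow> (\<Sum>y\<in>S. A x y * z y) = 0) \<Longrightarrow> \<forall>x\<in>S. z x = 0"
  shows "\<exists>z. \<forall>x\<in>S. (\<Sum>y\<in>S. A x y * z y) = b x"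
proof -
  define B where "B x c = (case c of None \<Rightarrow> - b x | Some y \<Rightarrow> A x y)" for x c
  let ?C = "insert None (Some ` S)"
  have "card S < card ?C"
    using assms(1) by (subst card_insert_disjoint) (auto simp: card_image)
  from underdetermined_homogeneous_system[OF assms(1) _ this, of B] assms(1)
  obtain z where z: "\<exists>c\<in>?C. z c \<noteq> 0" "\<And>x. x \<in> S \<Longrightarrow> (\<Sum>c\<in>?C. B x c * z c) = 0" by auto
  have eq: "(\<Sum>y\<in>S. A x y * z (Some y)) = b x * z None" if "x \<in> S" for x
  proof -
    have "(\<Sum>c\<in>?C. B x c * z c) = B x None * z None + (\<Sum>c\<in>Some ` S. B x c * z c)"
      using assms(1) by (subst sum.insert) auto
    also have "\<dots> = - b x * z None + (\<Sum>y\<in>S. A x y * z (Some y))"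
      by (simp add: B_def sum.reindex)
    finally show ?thesis using z(2)[OF that] by simp
  qed
  \<comment> \<open>If the coefficient of the column \<open>b\<close> vanished, the rest of
    \<open>z\<close> would be a nontrivial kernel vector of \<open>A\<close>. Division by this
    coefficient then gives the solution.\<close>
  have "z None \<noteq> 0"
  proof
    assume 0: "z None = 0"
    then have "\<forall>x\<in>S. z (Some x) = 0" using inj[of "\<lambda>y. z (Some y)"] eq by simp
    then show False using z(1) 0 by auto
  qed
  then have "(\<Sum>y\<in>S. A x y * (z (Some y) / z None)) = b x" if "x \<in> S" for x
    using eq[OF that] by (simp add: sum_divide_distrib[symmetric] field_simps)
  then show ?thesis by (intro exI[of _ "\<lambda>y. z (Some y) / z None"]) blast
qed

text \<open>Matrix-free form for difference operators: the matrix on \<open>S\<close> has the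
  entries \<open>L (\<delta> p) x\<close>, the values of \<open>L\<close> on unit functions. The
  single hypothesis \<open>lin\<close> covers additivity and homogeneity.\<close>

lemma injective_operator_solvable:
  fixes L :: "('a \<Rightarrow> real) \<Rightarrow> 'a \<Rightarrow> real"
  assumes fin: "finite S"
    and lin: "\<And>z c w x. L (\<lambda>y. z y + c * w y) x = L z x + c * L w x"
    and inj: "\<And>z. (\<And>x. x \<notin> S \<Longrightarrow> z x = 0) \<Longrightarrow> (\<And>x. x \<in> S \<Longrightarrow> L z x = 0) \<Longrightarrow> \<forall>x\<in>S. z x = 0"
  shows "\<exists>z. (\<forall>x. x \<notin> S \<longrightarrow> z x = 0) \<and> (\<forall>x\<in>S. L z x = b x)"
proof -
  have sum: "L (\<lambda>y. \<Sum>p\<in>Q. z p * g p y) x = (\<Sum>p\<in>Q. L (g p) x * z p)" if "finite Q" for Q z x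
    and g :: "'a \<Rightarrow> 'a \<Rightarrow> real"
    using that
  proof induction
    case empty
    \<comment> \<open>The instance \<open>0 + (-1) * 0\<close> of \<open>lin\<close> gives that
      \<open>L\<close> maps the zero function to zero.\<close>
    show ?case using lin[of "\<lambda>_. 0" "-1" "\<lambda>_. 0" x] by simp
  next
    case (insert p Q)
    then show ?case using lin[of "\<lambda>y. \<Sum>p\<in>Q. z p * g p y" "z p" "g p" x] by (simp add: ac_simps)
  qed
  define \<delta> where "\<delta> p y = (if y = p then 1 else 0 :: real)" for p y :: 'a
  have \<delta>: "(\<Sum>p\<in>S. z p * \<delta> p y) = (if y \<in> S then z y else 0)" for z y
  proof -
    have "(\<Sum>p\<in>S. z p * \<delta> p y) = (\<Sum>p\<in>S. if y = p then z p else 0)"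
      by (intro sum.cong) (auto simp: \<delta>_def)
    then show ?thesis using fin by simp
  qed
  have "\<exists>z. \<forall>x\<in>S. (\<Sum>p\<in>S. L (\<delta> p) x * z p) = b x"
  proof (rule injective_system_solvable[OF fin])
    fix z
    assume z: "\<And>x. x \<in> S \<Longrightarrow> (\<Sum>p\<in>S. L (\<delta> p) x * z p) = 0"
    have "\<forall>x\<in>S. (\<Sum>p\<in>S. z p * \<delta> p x) = 0"
    proof (rule inj)
      show "L (\<lambda>y. \<Sum>p\<in>S. z p * \<delta> p y) x = 0" if "x \<in> S" for x
        using z[OF that] sum[OF fin, of z \<delta> x] by simp
    qed (simp add: \<delta>)
    then show "\<forall>x\<in>S. z x = 0" by (simp add: \<delta>)
  qed
  then obtain z where "\<forall>x\<in>S. (\<Sum>p\<in>S. L (\<delta> p) x * z p) = b x" ..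
  then show ?thesis
    by (intro exI[of _ "\<lambda>y. \<Sum>p\<in>S. z p * \<delta> p y"]) (simp only: sum[OF fin], simp add: \<delta>)
qed

section \<open>Difference operators on the grid\<close>

lemma finite_vec_set:
  fixes F :: "'n::finite \<Rightarrow> 'a set"
  assumes "\<And>i. finite (F i)"
  shows "finite {x :: 'a^'n. \<forall>i. x $ i \<in> F i}"
proof -
  have "{x :: 'a^'n. \<forall>i. x $ i \<in> F i} \<subseteq> vec_lambda ` (PiE UNIV F)"
  proof
    fix x :: "'a^'n" assume "x \<in> {x. \<forall>i. x $ i \<in> F i}"
    then have "(\<lambda>i. x $ i) \<in> PiE UNIV F" "x = vec_lambda (\<lambda>i. x $ i)" by auto
    then show "x \<in> vec_lambda ` (PiE UNIV F)" by blast
  qed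
  then show ?thesis by (rule finite_subset) (auto intro!: finite_PiE assms)
qed

lemma finite_grid_inter_bounded:
  assumes "bounded B" "h > 0"
  shows "finite (B \<inter> grid h)"
proof -
  obtain K where K: "\<And>x. x \<in> B \<Longrightarrow> norm x \<le> K" using assms(1) by (auto simp: bounded_iff)
  define F where "F = (\<lambda>z. h * of_int z) ` {\<lfloor>- K / h\<rfloor>..\<lceil>K / h\<rceil>}"
  have "B \<inter> grid h \<subseteq> {x. \<forall>i. x $ i \<in> F}"
  proof safe
    fix x i assume x: "x \<in> B" "x \<in> grid h"
    then obtain z :: int where z: "x $ i = h * of_int z" unfolding grid_def by blast
    have "\<bar>x $ i\<bar> \<le> K" using K[OF x(1)] component_le_norm_cart[of x i] by linarith
    then have "- K / h \<le> of_int z" "of_int z \<le> K / h" using z assms(2) by (auto simp: field_simps abs_le_iff)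
    then have "z \<in> {\<lfloor>- K / h\<rfloor>..\<lceil>K / h\<rceil>}" by (auto; linarith)
    then show "x $ i \<in> F" unfolding F_def z by blast
  qed
  then show ?thesis
    by (rule finite_subset) (intro finite_vec_set, simp add: F_def)
qed

text \<open>The hypotheses place the supports of \<open>F\<close> and of its translate by
  \<open>e\<close> inside \<open>A\<close>, so the translation only reindexes the nonzero
  terms.\<close>

lemma sum_translate:
  fixes F :: "'a::ab_group_add \<Rightarrow> 'b::comm_monoid_add"
  assumes "finite A" "\<And>x. x \<notin> A \<Longrightarrow> F x = 0" "\<And>x. x \<notin> A \<Longrightarrow> F (x - e) = 0"
  shows "(\<Sum>x\<in>A. F (x - e)) = (\<Sum>x\<in>A. F x)"
proof -
  let ?S = "{x. F x \<noteq> 0}"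
  have "?S \<subseteq> A" using assms(2) by auto
  have sub: "(\<lambda>x. x + e) ` ?S \<subseteq> A" using assms(3) by force
  have "(\<Sum>x\<in>A. F x) = (\<Sum>x\<in>?S. F x)"
    using \<open>?S \<subseteq> A\<close> by (intro sum.mono_neutral_right assms(1)) auto
  also have "\<dots> = (\<Sum>x\<in>(\<lambda>x. x + e) ` ?S. F (x - e))"
    by (subst sum.reindex) (auto simp: inj_on_def)
  also have "\<dots> = (\<Sum>x\<in>A. F (x - e))"
  proof (intro sum.mono_neutral_left assms(1) sub ballI)
    fix x assume "x \<in> A - (\<lambda>x. x + e) ` ?S"
    then show "F (x - e) = 0" by (metis (mono_tags) DiffD2 diff_add_cancel image_eqI mem_Collect_eq)
  qed
  finally show ?thesis by simp
qed

lemma D_sq_eq: "h \<noteq> 0 \<Longrightarrow> D_sq h j \<phi> x = D_minus h j (D_plus h j \<phi>) x"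
  by (simp add: D_sq_def D_minus_def D_plus_def power2_eq_square scaleR_diff_right
      scaleR_add_right algebra_simps scaleR_2)

lemma D_plus_component: "D_plus h j (\<lambda>y. w y $ i) x = D_plus h j w x $ i"
  by (simp add: D_plus_def)

section \<open>The momentum equation as a scalar linear equation for each component\<close>

definition convection :: "real \<Rightarrow> (vec3 \<Rightarrow> vec3) \<Rightarrow> (vec3 \<Rightarrow> real) \<Rightarrow> vec3 \<Rightarrow> real" where
  "convection h u w x =
    (\<Sum>j\<in>UNIV. (u (x - h *\<^sub>R axis j 1) $ j * D_plus h j w (x - h *\<^sub>R axis j 1)
               + u x $ j * D_plus h j w x) / 2)"

text \<open>All terms with the unknown \<open>w\<close>, for one velocity component. The velocity
  \<open>u\<close> is the known one of the previous level, which makes the operator linear in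
  \<open>w\<close> and the same for all three components.\<close>

definition momentum_op :: "real \<Rightarrow> real \<Rightarrow> (vec3 \<Rightarrow> vec3) \<Rightarrow> (vec3 \<Rightarrow> real) \<Rightarrow> vec3 \<Rightarrow> real" where
  "momentum_op h \<tau> u w x = w x / \<tau> + convection h u w x - (\<Sum>j\<in>UNIV. D_sq h j w x)"

lemma momentum_eq_iff:
  assumes "\<tau> \<noteq> 0"
  shows "momentum_eq h \<tau> \<Omega> u w g \<longleftrightarrow>
    (\<forall>x\<in>grid_int h \<Omega>. \<forall>i. momentum_op h \<tau> u (\<lambda>y. w y $ i) x = u x $ i / \<tau> + g x $ i)"
  unfolding momentum_eq_def momentum_op_def convection_def diff_divide_distrib
  by (intro ball_cong refl arg_cong[of _ _ All] ext) linarith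

text \<open>Stated in the form of the hypothesis \<open>lin\<close> of
  \<open>injective_operator_solvable\<close>.\<close>

lemma momentum_op_linear:
  "momentum_op h \<tau> u (\<lambda>y. z y + c * w y) x = momentum_op h \<tau> u z x + c * momentum_op h \<tau> u w x"
proof -
  have plus: "D_plus h j (\<lambda>y. z y + c * w y) x = D_plus h j z x + c * D_plus h j w x" for j x
    by (simp add: D_plus_def algebra_simps)
  have sq: "D_sq h j (\<lambda>y. z y + c * w y) x = D_sq h j z x + c * D_sq h j w x" for j
    by (simp add: D_sq_def algebra_simps)
  have split: "(a * (p + c * q) + b * (r + c * s)) / 2 = (a * p + b * r) / 2 + c * ((a * q + b * s) / 2)"
    for a b p q r s :: real
    by (simp add: algebra_simps add_divide_distrib)
  show ?thesis
    unfolding momentum_op_def convection_def plus sq split sum.distrib sum_distrib_left[symmetric]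
    by (simp add: algebra_simps add_divide_distrib)
qed

section \<open>Grid functions and summation by parts\<close>

locale mesh =
  fixes h :: real and \<Omega> :: "vec3 set"
  assumes h_pos: "h > 0" and bounded_domain: "bounded \<Omega>"
begin

abbreviation nodes where "nodes \<equiv> grid_dom h \<Omega>"
abbreviation interior_nodes where "interior_nodes \<equiv> grid_int h \<Omega>"
abbreviation e where "e j \<equiv> h *\<^sub>R axis j (1::real) :: vec3"

lemma finite_nodes: "finite nodes"
  using finite_grid_inter_bounded[OF bounded_domain h_pos]
  by (rule finite_subset[rotated]) (auto simp: grid_dom_def)

lemma inner_subset: "interior_nodes \<subseteq> nodes"
  by (auto simp: grid_int_def)

lemma finite_inner: "finite interior_nodes"
  using inner_subset finite_nodes by (rule finite_subset)

lemma inner_neighbour: "x \<in> interior_nodes \<Longrightarrow> x + e j \<in> nodes" "x \<in> interior_nodes \<Longrightarrow> x - e j \<in> nodes"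
  unfolding grid_int_def grid_boundary_def by blast+

text \<open>Merges the extension by zero and the boundary condition into one support condition, the
  form needed for linear systems indexed by interior nodes.\<close>

lemma zero_off_inner_iff:
  fixes w :: "vec3 \<Rightarrow> 'b::zero"
  shows "(\<forall>x. x \<notin> interior_nodes \<longrightarrow> w x = 0) \<longleftrightarrow>
    w \<in> grid_funs h \<Omega> \<and> (\<forall>x\<in>grid_boundary h nodes. w x = 0)"
proof -
  have "grid_boundary h nodes \<subseteq> nodes" by (auto simp: grid_boundary_def)
  then show ?thesis unfolding grid_int_def grid_funs_def by blast
qed

text \<open>If \<open>x + e j\<close> were interior, its neighbour \<open>x\<close> would be a node.
  Hence the difference quotient may itself be an argument of
  \<open>summation_by_parts\<close>.\<close>

lemma D_plus_zero_off_nodes: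
  assumes "\<And>x. x \<notin> interior_nodes \<Longrightarrow> w x = 0" "x \<notin> nodes"
  shows "D_plus h j w x = 0"
proof -
  have "x + e j \<notin> interior_nodes" using inner_neighbour(2)[of "x + e j" j] assms(2) by auto
  then show ?thesis using assms inner_subset by (auto simp: D_plus_def)
qed

lemma summation_by_parts:
  fixes \<phi> \<psi> :: "vec3 \<Rightarrow> real"
  assumes "\<And>x. x \<notin> nodes \<Longrightarrow> \<phi> x = 0" "\<And>x. x \<notin> nodes \<Longrightarrow> \<psi> x = 0"
  shows "(\<Sum>x\<in>nodes. \<phi> x * D_minus h j \<psi> x) = - (\<Sum>x\<in>nodes. D_plus h j \<phi> x * \<psi> x)"
proof -
  \<comment> \<open>Translation of the product \<phi>(x + e j) \<psi>(x): it vanishes off the nodes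
    because of \<psi>, its translate because of \<phi>. Therefore no boundary terms appear.\<close>
  have "(\<Sum>x\<in>nodes. \<phi> (x - e j + e j) * \<psi> (x - e j)) = (\<Sum>x\<in>nodes. \<phi> (x + e j) * \<psi> x)"
    by (rule sum_translate[OF finite_nodes]) (auto simp: assms)
  then have "(\<Sum>x\<in>nodes. \<phi> x * \<psi> (x - e j)) = (\<Sum>x\<in>nodes. \<phi> (x + e j) * \<psi> x)" by simp
  moreover have "(\<Sum>x\<in>nodes. \<phi> x * D_minus h j \<psi> x) =
      ((\<Sum>x\<in>nodes. \<phi> x * \<psi> x) - (\<Sum>x\<in>nodes. \<phi> x * \<psi> (x - e j))) / h"
    by (simp add: D_minus_def sum_subtractf[symmetric] sum_divide_distrib field_simps)
  moreover have "(\<Sum>x\<in>nodes. D_plus h j \<phi> x * \<psi> x) =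
      ((\<Sum>x\<in>nodes. \<phi> (x + e j) * \<psi> x) - (\<Sum>x\<in>nodes. \<phi> x * \<psi> x)) / h"
    by (simp add: D_plus_def sum_subtractf[symmetric] sum_divide_distrib field_simps)
  ultimately show ?thesis by (simp add: diff_divide_distrib)
qed

text \<open>Summation by parts with \<psi> = \<open>D_plus h j w\<close>. Support in the interior,
  not just in the nodes, is what makes this \<psi> vanish off the nodes.\<close>

lemma sum_laplacian:
  fixes w :: "vec3 \<Rightarrow> real"
  assumes "\<And>x. x \<notin> interior_nodes \<Longrightarrow> w x = 0"
  shows "(\<Sum>x\<in>nodes. w x * D_sq h j w x) = - (\<Sum>x\<in>nodes. (D_plus h j w x)\<^sup>2)"
proof -
  have "(\<Sum>x\<in>nodes. w x * D_minus h j (D_plus h j w) x) =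
      - (\<Sum>x\<in>nodes. D_plus h j w x * D_plus h j w x)"
    using assms inner_subset
    by (intro summation_by_parts D_plus_zero_off_nodes) auto
  then show ?thesis using h_pos by (simp add: D_sq_eq power2_eq_square)
qed

lemma sum_grad_div:
  assumes "\<And>x. x \<notin> nodes \<Longrightarrow> \<phi> x = 0" "\<And>x. x \<notin> nodes \<Longrightarrow> v x = 0"
  shows "(\<Sum>x\<in>nodes. \<phi> x * grid_div h v x) = - (\<Sum>x\<in>nodes. grid_grad h \<phi> x \<bullet> v x)"
proof -
  have "(\<Sum>x\<in>nodes. \<phi> x * grid_div h v x) =
      (\<Sum>j\<in>UNIV. \<Sum>x\<in>nodes. \<phi> x * D_minus h j (\<lambda>y. v y $ j) x)"
    unfolding grid_div_def sum_distrib_left by (rule sum.swap)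
  also have "\<dots> = (\<Sum>j\<in>UNIV. - (\<Sum>x\<in>nodes. D_plus h j \<phi> x * v x $ j))"
    by (intro sum.cong summation_by_parts) (auto simp: assms)
  also have "\<dots> = - (\<Sum>x\<in>nodes. grid_grad h \<phi> x \<bullet> v x)"
    unfolding sum_negf by (subst sum.swap) (simp add: grid_grad_def inner_vec_def)
  finally show ?thesis .
qed

text \<open>Up to the difference of \<open>u\<^sub>j w w(\<cdot> + h e\<^sup>j)\<close> and its translate, \<open>w\<close> times the convection
  term is \<open>- (\<D> \<cdot> u) w\<^sup>2 / 2\<close>.\<close>

lemma sum_convection:
  assumes u: "\<And>x. x \<notin> nodes \<Longrightarrow> u x = 0" "\<And>x. x \<in> interior_nodes \<Longrightarrow> grid_div h u x = 0"
    and w: "\<And>x. x \<notin> interior_nodes \<Longrightarrow> w x = 0"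
  shows "(\<Sum>x\<in>nodes. w x * convection h u w x) = 0"
proof -
  define F where "F j x = u x $ j * w x * w (x + e j)" for j x
  \<comment> \<open>Both \<open>F j x\<close> and \<open>F j (x - e j)\<close> contain the factor
    \<open>w x\<close>, so both vanish off the nodes.\<close>
  have F: "(\<Sum>x\<in>nodes. F j (x - e j)) = (\<Sum>x\<in>nodes. F j x)" for j
    using w inner_subset by (intro sum_translate finite_nodes) (auto simp: F_def)
  have pt: "w x * ((u (x - e j) $ j * D_plus h j w (x - e j) + u x $ j * D_plus h j w x) / 2) =
      (F j x - F j (x - e j)) / (2 * h) - (w x)\<^sup>2 * D_minus h j (\<lambda>y. u y $ j) x / 2" for x j
    using h_pos by (simp add: F_def D_plus_def D_minus_def power2_eq_square field_simps)
  have "w x * convection h u w x =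
      (\<Sum>j\<in>UNIV. (F j x - F j (x - e j)) / (2 * h)) - (w x)\<^sup>2 * grid_div h u x / 2" for x
    unfolding convection_def grid_div_def sum_distrib_left pt
    by (simp only: sum_subtractf sum_distrib_left sum_divide_distrib)
  \<comment> \<open>The divergence is controlled on interior nodes only; elsewhere the factor
    \<open>w x\<close> is zero.\<close>
  moreover have "(w x)\<^sup>2 * grid_div h u x = 0" for x
    using u(2) w by (cases "x \<in> interior_nodes") auto
  ultimately have "(\<Sum>x\<in>nodes. w x * convection h u w x) =
      (\<Sum>x\<in>nodes. \<Sum>j\<in>UNIV. (F j x - F j (x - e j)) / (2 * h))"
    by simp
  also have "\<dots> = (\<Sum>j\<in>UNIV. \<Sum>x\<in>nodes. (F j x - F j (x - e j)) / (2 * h))"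
    by (rule sum.swap)
  also have "\<dots> = 0"
    by (simp add: sum_divide_distrib[symmetric] sum_subtractf F)
  finally show ?thesis .
qed

text \<open>Coercivity: convection cancels and the Laplacian becomes a sum of squares. Both the
  injectivity of the operator and the energy identity rest on this.\<close>

lemma sum_momentum_op:
  assumes "\<And>x. x \<notin> nodes \<Longrightarrow> u x = 0" "\<And>x. x \<in> interior_nodes \<Longrightarrow> grid_div h u x = 0"
    and "\<And>x. x \<notin> interior_nodes \<Longrightarrow> w x = 0"
  shows "(\<Sum>x\<in>nodes. w x * momentum_op h \<tau> u w x) =
    (\<Sum>x\<in>nodes. (w x)\<^sup>2) / \<tau> + (\<Sum>j\<in>UNIV. \<Sum>x\<in>nodes. (D_plus h j w x)\<^sup>2)"
proof -
  have "(\<Sum>x\<in>nodes. w x * momentum_op h \<tau> u w x) =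
     (\<Sum>x\<in>nodes. (w x)\<^sup>2) / \<tau> + (\<Sum>x\<in>nodes. w x * convection h u w x)
     - (\<Sum>x\<in>nodes. \<Sum>j\<in>UNIV. w x * D_sq h j w x)"
    unfolding momentum_op_def
    by (simp add: algebra_simps sum.distrib sum_subtractf sum_distrib_left sum_divide_distrib
        power2_eq_square)
  also have "(\<Sum>x\<in>nodes. w x * convection h u w x) = 0" by (rule sum_convection[OF assms])
  also have "(\<Sum>x\<in>nodes. \<Sum>j\<in>UNIV. w x * D_sq h j w x) =
      (\<Sum>j\<in>UNIV. - (\<Sum>x\<in>nodes. (D_plus h j w x)\<^sup>2))"
    by (subst sum.swap) (simp add: sum_laplacian[OF assms(3)])
  finally show ?thesis by (simp add: sum_negf)
qed

section \<open>Unique solvability of the half step\<close>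

lemma momentum_op_solvable:
  assumes u: "\<And>x. x \<notin> nodes \<Longrightarrow> u x = 0" "\<And>x. x \<in> interior_nodes \<Longrightarrow> grid_div h u x = 0"
    and "\<tau> > 0"
  shows "\<exists>!w. (\<forall>x. x \<notin> interior_nodes \<longrightarrow> w x = 0) \<and> (\<forall>x\<in>interior_nodes. momentum_op h \<tau> u w x = b x)"
proof -
  \<comment> \<open>A kernel element tested with itself makes a sum of nonnegative terms vanish, in
    particular the sum of its squares.\<close>
  have inj: "w x = 0"
    if w: "\<And>x. x \<notin> interior_nodes \<Longrightarrow> w x = 0" and L: "\<And>x. x \<in> interior_nodes \<Longrightarrow> momentum_op h \<tau> u w x = 0"
    for w x
  proof (cases "x \<in> interior_nodes")
    case True
    have "(\<Sum>x\<in>nodes. w x * momentum_op h \<tau> u w x) = 0"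
    proof (rule sum.neutral, rule ballI)
      fix x show "w x * momentum_op h \<tau> u w x = 0" using w L by (cases "x \<in> interior_nodes") auto
    qed
    then have "(\<Sum>x\<in>nodes. (w x)\<^sup>2) / \<tau> + (\<Sum>j\<in>UNIV. \<Sum>x\<in>nodes. (D_plus h j w x)\<^sup>2) = 0"
      using sum_momentum_op[OF u w] by simp
    moreover have "(\<Sum>j\<in>UNIV. \<Sum>x\<in>nodes. (D_plus h j w x)\<^sup>2) \<ge> 0" by (intro sum_nonneg) auto
    moreover have "(\<Sum>x\<in>nodes. (w x)\<^sup>2) / \<tau> \<ge> 0"
      using \<open>\<tau> > 0\<close> by (intro divide_nonneg_pos sum_nonneg) auto
    ultimately have "(\<Sum>x\<in>nodes. (w x)\<^sup>2) / \<tau> = 0" by linarith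
    then have "(\<Sum>x\<in>nodes. (w x)\<^sup>2) = 0" using \<open>\<tau> > 0\<close> by simp
    then show ?thesis using True inner_subset by (auto simp: sum_nonneg_eq_0_iff[OF finite_nodes])
  qed (rule w)
  have "\<exists>w. (\<forall>x. x \<notin> interior_nodes \<longrightarrow> w x = 0) \<and> (\<forall>x\<in>interior_nodes. momentum_op h \<tau> u w x = b x)"
    using inj by (intro injective_operator_solvable finite_inner momentum_op_linear) blast
  moreover have "w = z"
    if w: "\<forall>x. x \<notin> interior_nodes \<longrightarrow> w x = 0" "\<forall>x\<in>interior_nodes. momentum_op h \<tau> u w x = b x"
      and z: "\<forall>x. x \<notin> interior_nodes \<longrightarrow> z x = 0" "\<forall>x\<in>interior_nodes. momentum_op h \<tau> u z x = b x" for w z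
  proof
    fix x
    \<comment> \<open>The difference of two solutions, written so that
      \<open>momentum_op_linear\<close> applies, lies in the kernel.\<close>
    have "w x + (-1) * z x = 0"
    proof (rule inj)
      show "momentum_op h \<tau> u (\<lambda>x. w x + (-1) * z x) y = 0" if "y \<in> interior_nodes" for y
        using w z that by (simp add: momentum_op_linear[of h \<tau> u w "-1" z, simplified])
    qed (use w z in auto)
    then show "w x = z x" by simp
  qed
  ultimately show ?thesis by blast
qed

text \<open>The three scalar problems are solved independently and assembled; conversely each
  component of a solution solves its scalar problem and is fixed by uniqueness there.\<close>

lemma momentum_eq_unique_solution:
  assumes u: "\<And>x. x \<notin> nodes \<Longrightarrow> u x = 0" "\<And>x. x \<in> interior_nodes \<Longrightarrow> grid_div h u x = 0"
    and \<tau>: "\<tau> > 0"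
  shows "\<exists>!w. (\<forall>x. x \<notin> interior_nodes \<longrightarrow> w x = 0) \<and> momentum_eq h \<tau> \<Omega> u w g"
proof -
  define b where "b i x = u x $ i / \<tau> + g x $ i" for i x
  define Q where "Q i w \<longleftrightarrow> (\<forall>x. x \<notin> interior_nodes \<longrightarrow> w x = 0) \<and>
    (\<forall>x\<in>interior_nodes. momentum_op h \<tau> u w x = b i x)" for i w
  have Q: "\<exists>!w. Q i w" for i
    unfolding Q_def by (rule momentum_op_solvable[OF u \<tau>])
  define W where "W i = (THE w. Q i w)" for i
  have "Q i (W i)" for i unfolding W_def by (rule theI'[OF Q])
  then have W: "\<And>i x. x \<notin> interior_nodes \<Longrightarrow> W i x = 0"
    "\<And>i x. x \<in> interior_nodes \<Longrightarrow> momentum_op h \<tau> u (W i) x = b i x" by (auto simp: Q_def)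
  have uniq: "w = (\<lambda>x. \<chi> i. W i x)" if w: "\<forall>x. x \<notin> interior_nodes \<longrightarrow> w x = 0" "momentum_eq h \<tau> \<Omega> u w g" for w
  proof -
    have "(\<lambda>y. w y $ i) = W i" for i
    proof -
      have "Q i (\<lambda>y. w y $ i)"
        using w \<tau> by (auto simp: momentum_eq_iff b_def Q_def)
      then show ?thesis unfolding W_def by (rule the1_equality[OF Q, symmetric])
    qed
    then have "w x $ i = W i x" for x i by (rule fun_cong)
    then show ?thesis by (simp add: vec_eq_iff fun_eq_iff)
  qed
  have "(\<forall>x. x \<notin> interior_nodes \<longrightarrow> (\<chi> i. W i x) = 0) \<and> momentum_eq h \<tau> \<Omega> u (\<lambda>x. \<chi> i. W i x) g"
    using W \<tau> by (auto simp: momentum_eq_iff b_def vec_eq_iff)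
  then show ?thesis by (intro ex1I[of _ "\<lambda>x. \<chi> i. W i x"]) (auto intro: uniq)
qed

section \<open>Discrete norms and the energy estimate\<close>

lemma grid_inner_self_nonneg: "grid_inner h \<Omega> u u \<ge> 0"
  using h_pos by (auto simp: grid_inner_def intro!: sum_nonneg)

lemma grid_norm_nonneg: "grid_norm h \<Omega> u \<ge> 0"
  by (simp add: grid_norm_def grid_inner_self_nonneg)

lemma grid_norm_sq: "(grid_norm h \<Omega> u)\<^sup>2 = grid_inner h \<Omega> u u"
  by (simp add: grid_norm_def grid_inner_self_nonneg)

lemma grid_norm_sq_sum: "(grid_norm h \<Omega> u)\<^sup>2 = (\<Sum>x\<in>nodes. (norm (u x))\<^sup>2 * h ^ 3)"
  by (simp add: grid_norm_sq grid_inner_def power2_norm_eq_inner)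

text \<open>Cauchy-Schwarz for finite sums, with the cell volume split as
  \<open>sqrt (h ^ 3)\<close> between the two factors.\<close>

lemma grid_inner_le: "grid_inner h \<Omega> u w \<le> grid_norm h \<Omega> u * grid_norm h \<Omega> w"
proof -
  have "grid_inner h \<Omega> u w \<le> (\<Sum>x\<in>nodes. (norm (u x) * sqrt (h ^ 3)) * (norm (w x) * sqrt (h ^ 3)))"
    unfolding grid_inner_def
  proof (rule sum_mono)
    fix x
    have "(a * sqrt (h ^ 3)) * (b * sqrt (h ^ 3)) = a * b * (sqrt (h ^ 3))\<^sup>2" for a b
      by (simp add: power2_eq_square del: real_sqrt_power)
    then have "(norm (u x) * sqrt (h ^ 3)) * (norm (w x) * sqrt (h ^ 3)) = norm (u x) * norm (w x) * h ^ 3"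
      using h_pos by (simp del: real_sqrt_power)
    moreover have "u x \<bullet> w x * h ^ 3 \<le> norm (u x) * norm (w x) * h ^ 3"
      using h_pos norm_cauchy_schwarz by (intro mult_right_mono) auto
    ultimately show "u x \<bullet> w x * h ^ 3 \<le> (norm (u x) * sqrt (h ^ 3)) * (norm (w x) * sqrt (h ^ 3))"
      by linarith
  qed
  also have "\<dots> \<le> L2_set (\<lambda>x. norm (u x) * sqrt (h ^ 3)) nodes * L2_set (\<lambda>x. norm (w x) * sqrt (h ^ 3)) nodes"
    using L2_set_mult_ineq[of "\<lambda>x. norm (u x) * sqrt (h ^ 3)" "\<lambda>x. norm (w x) * sqrt (h ^ 3)" nodes] h_pos
    by (simp add: abs_mult)
  also have "\<dots> = grid_norm h \<Omega> u * grid_norm h \<Omega> w"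
    using h_pos by (simp add: L2_set_def grid_norm_def grid_inner_def power_mult_distrib power2_norm_eq_inner)
  finally show ?thesis .
qed

text \<open>Each component of the equation is tested with the same component of \<open>w\<close>;
  the results are summed and multiplied by \<open>h ^ 3\<close> and \<tau>.\<close>

lemma energy_identity:
  assumes u: "\<And>x. x \<notin> nodes \<Longrightarrow> u x = 0" "\<And>x. x \<in> interior_nodes \<Longrightarrow> grid_div h u x = 0"
    and w: "\<And>x. x \<notin> interior_nodes \<Longrightarrow> w x = 0" and eq: "momentum_eq h \<tau> \<Omega> u w g" and \<tau>: "\<tau> > 0"
  shows "(grid_norm h \<Omega> w)\<^sup>2 + (\<Sum>j\<in>UNIV. (grid_norm h \<Omega> (D_plus h j w))\<^sup>2) * \<tau> =
    grid_inner h \<Omega> u w + \<tau> * grid_inner h \<Omega> g w"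
proof -
  have comp: "(\<Sum>x\<in>nodes. (w x $ i)\<^sup>2) + \<tau> * (\<Sum>j\<in>UNIV. \<Sum>x\<in>nodes. (D_plus h j w x $ i)\<^sup>2) =
      (\<Sum>x\<in>nodes. u x $ i * w x $ i) + \<tau> * (\<Sum>x\<in>nodes. g x $ i * w x $ i)" for i
  proof -
    have "(\<Sum>x\<in>nodes. w x $ i * momentum_op h \<tau> u (\<lambda>y. w y $ i) x) =
        (\<Sum>x\<in>nodes. w x $ i * (u x $ i / \<tau> + g x $ i))"
    \<comment> \<open>The equation holds only at interior nodes, but at the others the test function
      is zero.\<close>
    proof (rule sum.cong[OF refl])
      fix x show "w x $ i * momentum_op h \<tau> u (\<lambda>y. w y $ i) x = w x $ i * (u x $ i / \<tau> + g x $ i)"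
        using w eq \<tau> by (cases "x \<in> interior_nodes") (auto simp: momentum_eq_iff)
    qed
    also have "(\<Sum>x\<in>nodes. w x $ i * momentum_op h \<tau> u (\<lambda>y. w y $ i) x) =
        (\<Sum>x\<in>nodes. (w x $ i)\<^sup>2) / \<tau> + (\<Sum>j\<in>UNIV. \<Sum>x\<in>nodes. (D_plus h j (\<lambda>y. w y $ i) x)\<^sup>2)"
      using w by (intro sum_momentum_op[OF u]) auto
    also have "(\<Sum>x\<in>nodes. w x $ i * (u x $ i / \<tau> + g x $ i)) =
        (\<Sum>x\<in>nodes. u x $ i * w x $ i) / \<tau> + (\<Sum>x\<in>nodes. g x $ i * w x $ i)"
      by (simp add: sum.distrib sum_divide_distrib algebra_simps)
    finally show ?thesis using \<tau> by (simp add: D_plus_component field_simps)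
  qed
  have norm: "(grid_norm h \<Omega> v)\<^sup>2 = h ^ 3 * (\<Sum>i\<in>UNIV. \<Sum>x\<in>nodes. (v x $ i)\<^sup>2)" for v
    unfolding grid_norm_sq grid_inner_def inner_vec_def
    by (subst sum.swap) (simp add: sum_distrib_left power2_eq_square mult.commute)
  have prod: "grid_inner h \<Omega> v w = h ^ 3 * (\<Sum>i\<in>UNIV. \<Sum>x\<in>nodes. v x $ i * w x $ i)" for v
    unfolding grid_inner_def inner_vec_def
    by (subst sum.swap) (simp add: sum_distrib_left mult.commute)
  have D: "(\<Sum>j\<in>UNIV. (grid_norm h \<Omega> (D_plus h j w))\<^sup>2) =
      h ^ 3 * (\<Sum>i\<in>UNIV. \<Sum>j\<in>UNIV. \<Sum>x\<in>nodes. (D_plus h j w x $ i)\<^sup>2)"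
    unfolding norm by (subst sum.swap) (simp add: sum_distrib_left)
  have "(\<Sum>i\<in>UNIV. (\<Sum>x\<in>nodes. (w x $ i)\<^sup>2) + \<tau> * (\<Sum>j\<in>UNIV. \<Sum>x\<in>nodes. (D_plus h j w x $ i)\<^sup>2)) =
      (\<Sum>i\<in>UNIV. (\<Sum>x\<in>nodes. u x $ i * w x $ i) + \<tau> * (\<Sum>x\<in>nodes. g x $ i * w x $ i))"
    by (simp only: comp)
  then have "(\<Sum>i\<in>UNIV. \<Sum>x\<in>nodes. (w x $ i)\<^sup>2)
      + \<tau> * (\<Sum>i\<in>UNIV. \<Sum>j\<in>UNIV. \<Sum>x\<in>nodes. (D_plus h j w x $ i)\<^sup>2) =
      (\<Sum>i\<in>UNIV. \<Sum>x\<in>nodes. u x $ i * w x $ i) + \<tau> * (\<Sum>i\<in>UNIV. \<Sum>x\<in>nodes. g x $ i * w x $ i)"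
    by (simp only: sum.distrib sum_distrib_left)
  from arg_cong[OF this, of "\<lambda>s. h ^ 3 * s"] show ?thesis
    unfolding norm[of w] prod D by (simp add: algebra_simps)
qed

text \<open>With \<open>?W\<close>, \<open>?D\<close>, \<open>?K\<close> as below, Cauchy-Schwarz
  turns the identity into \<open>?W\<^sup>2 + ?D \<le> ?K * ?W\<close>. Dropping \<open>?D\<close>
  and cancelling \<open>?W\<close> yields the first bound; inserting that bound on the right yields
  the second.\<close>

lemma energy_estimate:
  assumes u: "\<And>x. x \<notin> nodes \<Longrightarrow> u x = 0" "\<And>x. x \<in> interior_nodes \<Longrightarrow> grid_div h u x = 0"
    and w: "\<And>x. x \<notin> interior_nodes \<Longrightarrow> w x = 0" and eq: "momentum_eq h \<tau> \<Omega> u w g" and \<tau>: "\<tau> > 0"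
  shows "grid_norm h \<Omega> w \<le> grid_norm h \<Omega> u + grid_norm h \<Omega> g * \<tau>"
    and "(grid_norm h \<Omega> w)\<^sup>2 + (\<Sum>j\<in>UNIV. (grid_norm h \<Omega> (D_plus h j w))\<^sup>2) * \<tau> \<le>
      (grid_norm h \<Omega> u + grid_norm h \<Omega> g * \<tau>)\<^sup>2"
proof -
  let ?W = "grid_norm h \<Omega> w" and ?K = "grid_norm h \<Omega> u + grid_norm h \<Omega> g * \<tau>"
    and ?D = "(\<Sum>j\<in>UNIV. (grid_norm h \<Omega> (D_plus h j w))\<^sup>2) * \<tau>"
  have "grid_inner h \<Omega> u w + \<tau> * grid_inner h \<Omega> g w \<le>
      grid_norm h \<Omega> u * ?W + \<tau> * (grid_norm h \<Omega> g * ?W)"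
    using \<tau> by (intro add_mono mult_left_mono grid_inner_le) auto
  then have "?W\<^sup>2 + ?D \<le> grid_norm h \<Omega> u * ?W + \<tau> * (grid_norm h \<Omega> g * ?W)"
    using energy_identity[OF assms] by linarith
  then have le: "?W\<^sup>2 + ?D \<le> ?K * ?W" by (simp add: algebra_simps)
  have D: "?D \<ge> 0" using \<tau> by (intro mult_nonneg_nonneg sum_nonneg) auto
  have K: "?K \<ge> 0" using \<tau> by (intro add_nonneg_nonneg mult_nonneg_nonneg grid_norm_nonneg) auto
  show W: "?W \<le> ?K"
  proof (cases "?W = 0")
    case False
    then have "?W > 0" using grid_norm_nonneg[of w] by simp
    moreover have "?W * ?W \<le> ?K * ?W" using le D by (simp add: power2_eq_square)
    ultimately show ?thesis by simp
  qed (use K in simp)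
  have "?K * ?W \<le> ?K * ?K" using W K by (intro mult_left_mono)
  with le show "?W\<^sup>2 + ?D \<le> ?K\<^sup>2" by (simp add: power2_eq_square)
qed

subsection \<open>Discrete Helmholtz-Hodge decomposition\<close>

text \<open>Otherwise take a point of the finite support with the largest first coordinate. It is
  interior, so the vanishing forward difference there makes \<phi> nonzero one step further in
  direction 1, a contradiction.\<close>

lemma zero_of_grad_zero:
  assumes \<phi>: "\<And>x. x \<notin> interior_nodes \<Longrightarrow> \<phi> x = 0" and grad: "\<And>x. x \<in> interior_nodes \<Longrightarrow> grid_grad h \<phi> x = 0"
  shows "\<phi> x = 0"
proof (rule ccontr)
  assume "\<phi> x \<noteq> 0"
  let ?S = "{x. \<phi> x \<noteq> 0}"
  have "?S \<subseteq> interior_nodes" using \<phi> by auto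
  then have fin: "finite ?S" using finite_inner by (rule finite_subset)
  define m where "m = Max ((\<lambda>x. x $ 1) ` ?S)"
  have "m \<in> (\<lambda>x. x $ 1) ` ?S"
    unfolding m_def using fin \<open>\<phi> x \<noteq> 0\<close> by (intro Max_in) auto
  then obtain y where y: "\<phi> y \<noteq> 0" "y $ 1 = m" by auto
  then have "y \<in> interior_nodes" using \<phi> by auto
  then have "D_plus h 1 \<phi> y = 0" using grad[of y] by (simp add: grid_grad_def vec_eq_iff)
  then have "\<phi> (y + e 1) \<noteq> 0" using y h_pos by (simp add: D_plus_def)
  then have "(y + e 1) $ 1 \<in> (\<lambda>x. x $ 1) ` ?S" by blast
  then have "(y + e 1) $ 1 \<le> m" unfolding m_def using fin by (intro Max_ge finite_imageI)
  then show False using y h_pos by (simp add: axis_def)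
qed

text \<open>Summation by parts moves the gradient to the divergence of \<open>w\<close>, which is
  zero at interior nodes, while \<phi> is zero at all others.\<close>

lemma helmholtz_hodge_orthogonal:
  assumes "helmholtz_hodge h \<Omega> u w \<phi>"
  shows "(\<Sum>x\<in>nodes. grid_grad h \<phi> x \<bullet> w x) = 0"
proof -
  have "(\<forall>x. x \<notin> interior_nodes \<longrightarrow> w x = 0)" "(\<forall>x. x \<notin> interior_nodes \<longrightarrow> \<phi> x = 0)"
    using assms unfolding zero_off_inner_iff helmholtz_hodge_def by blast+
  note z = this
  have "\<phi> x * grid_div h w x = 0" for x
    using assms z by (cases "x \<in> interior_nodes") (auto simp: helmholtz_hodge_def)
  then have "(\<Sum>x\<in>nodes. \<phi> x * grid_div h w x) = 0" by (intro sum.neutral ballI)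
  moreover have "(\<Sum>x\<in>nodes. \<phi> x * grid_div h w x) = - (\<Sum>x\<in>nodes. grid_grad h \<phi> x \<bullet> w x)"
    using z inner_subset by (intro sum_grad_div) auto
  ultimately show ?thesis by simp
qed

text \<open>The decomposition tested with \<open>w\<close>. It holds only at interior nodes, which
  suffices because \<open>w\<close> vanishes elsewhere.\<close>

lemma grid_inner_helmholtz_hodge:
  assumes "helmholtz_hodge h \<Omega> u w \<phi>"
  shows "(grid_norm h \<Omega> w)\<^sup>2 = grid_inner h \<Omega> u w"
proof -
  have w: "\<forall>x. x \<notin> interior_nodes \<longrightarrow> w x = 0"
    using assms unfolding zero_off_inner_iff helmholtz_hodge_def by blast
  have "w x \<bullet> w x = u x \<bullet> w x - grid_grad h \<phi> x \<bullet> w x" for x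
  proof (cases "x \<in> interior_nodes")
    case True
    then have "u x = w x + grid_grad h \<phi> x" using assms by (simp add: helmholtz_hodge_def)
    then show ?thesis by (simp add: inner_add_left)
  qed (simp add: w)
  then have "(\<Sum>x\<in>nodes. w x \<bullet> w x) = (\<Sum>x\<in>nodes. u x \<bullet> w x)"
    using helmholtz_hodge_orthogonal[OF assms] by (simp add: sum_subtractf)
  then show ?thesis by (simp add: grid_norm_sq grid_inner_def sum_distrib_right[symmetric])
qed

lemma grid_norm_helmholtz_hodge:
  assumes "helmholtz_hodge h \<Omega> u w \<phi>"
  shows "grid_norm h \<Omega> w \<le> grid_norm h \<Omega> u"
proof (cases "grid_norm h \<Omega> w = 0")
  case False
  then have "grid_norm h \<Omega> w > 0" using grid_norm_nonneg[of w] by simp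
  moreover have "grid_norm h \<Omega> w * grid_norm h \<Omega> w \<le> grid_norm h \<Omega> u * grid_norm h \<Omega> w"
    using grid_inner_helmholtz_hodge[OF assms] grid_inner_le[of u w] by (simp add: power2_eq_square)
  ultimately show ?thesis by simp
qed (simp add: grid_norm_nonneg)

text \<open>Taking the divergence of the decomposition gives a discrete Poisson equation for \<phi>.
  Since \<open>w\<close> has to vanish off the interior, both \<open>u\<close> and the gradient are
  first set to zero there by \<open>cut\<close>; then \<open>w\<close> is the difference of the two
  truncated fields.\<close>

lemma helmholtz_hodge_exists: "\<exists>w \<phi>. helmholtz_hodge h \<Omega> u w \<phi>"
proof -
  define cut where "cut v x = (if x \<in> interior_nodes then v x else 0)" for v :: "vec3 \<Rightarrow> vec3" and x
  have cut0: "x \<notin> nodes \<Longrightarrow> cut v x = 0" for v x using inner_subset by (auto simp: cut_def)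
  define L where "L \<phi> x = grid_div h (cut (grid_grad h \<phi>)) x" for \<phi> x
  have div_add: "grid_div h (\<lambda>y. v y + c *\<^sub>R w y) x = grid_div h v x + c * grid_div h w x"
    for v w x and c :: real
    by (simp add: grid_div_def D_minus_def algebra_simps sum.distrib sum_subtractf sum_distrib_left)
  have grad_add: "grid_grad h (\<lambda>y. z y + c * w y) x = grid_grad h z x + c *\<^sub>R grid_grad h w x"
    for z w x and c :: real
    by (simp add: grid_grad_def D_plus_def vec_eq_iff algebra_simps)
  have cut_add: "cut (\<lambda>y. v y + c *\<^sub>R w y) x = cut v x + c *\<^sub>R cut w x" for v w x and c :: real
    by (simp add: cut_def)
  have "(\<lambda>x. cut (\<lambda>y. v y + c *\<^sub>R w y) x) = (\<lambda>x. cut v x + c *\<^sub>R cut w x)" for v w and c :: real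
    by (simp add: cut_add)
  then have L_lin: "L (\<lambda>y. z y + c * w y) x = L z x + c * L w x" for z w x and c :: real
    unfolding L_def grad_add by (simp add: div_add)
  have "\<exists>\<phi>. (\<forall>x. x \<notin> interior_nodes \<longrightarrow> \<phi> x = 0) \<and> (\<forall>x\<in>interior_nodes. L \<phi> x = grid_div h (cut u) x)"
  proof (rule injective_operator_solvable[OF finite_inner])
    show "L (\<lambda>y. z y + c * w y) x = L z x + c * L w x" for z c w x by (rule L_lin)
    fix \<phi> assume \<phi>: "\<And>x. x \<notin> interior_nodes \<Longrightarrow> \<phi> x = 0" and L: "\<And>x. x \<in> interior_nodes \<Longrightarrow> L \<phi> x = 0"
    have "\<phi> x * L \<phi> x = 0" for x using \<phi> L by (cases "x \<in> interior_nodes") auto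
    then have "(\<Sum>x\<in>nodes. \<phi> x * grid_div h (cut (grid_grad h \<phi>)) x) = 0"
      unfolding L_def by (intro sum.neutral ballI)
    moreover have "(\<Sum>x\<in>nodes. \<phi> x * grid_div h (cut (grid_grad h \<phi>)) x) =
        - (\<Sum>x\<in>nodes. grid_grad h \<phi> x \<bullet> cut (grid_grad h \<phi>) x)"
      using \<phi> inner_subset by (intro sum_grad_div cut0) auto
    ultimately have s: "(\<Sum>x\<in>nodes. grid_grad h \<phi> x \<bullet> cut (grid_grad h \<phi>) x) = 0" by simp
    \<comment> \<open>Each summand is the squared length of the gradient at an interior node and
      zero at the other nodes.\<close>
    have "\<forall>x\<in>nodes. grid_grad h \<phi> x \<bullet> cut (grid_grad h \<phi>) x = 0"
      using s by (subst (asm) sum_nonneg_eq_0_iff[OF finite_nodes]) (auto simp: cut_def)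
    then have "grid_grad h \<phi> x = 0" if "x \<in> interior_nodes" for x
      using bspec[of nodes _ x] that inner_subset by (auto simp: cut_def split: if_splits)
    then show "\<forall>x\<in>interior_nodes. \<phi> x = 0" using zero_of_grad_zero \<phi> by blast
  qed
  then obtain \<phi> where \<phi>: "\<And>x. x \<notin> interior_nodes \<Longrightarrow> \<phi> x = 0"
    "\<And>x. x \<in> interior_nodes \<Longrightarrow> L \<phi> x = grid_div h (cut u) x" by blast
  define w where "w = (\<lambda>x. cut u x + (-1) *\<^sub>R cut (grid_grad h \<phi>) x)"
  have "\<forall>x. x \<notin> interior_nodes \<longrightarrow> w x = 0" "\<forall>x. x \<notin> interior_nodes \<longrightarrow> \<phi> x = 0"
    using \<phi> by (auto simp: w_def cut_def)
  moreover have "grid_div h w x = 0" if "x \<in> interior_nodes" for x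
    unfolding w_def div_add using \<phi>(2)[OF that] by (simp add: L_def)
  moreover have "w x + grid_grad h \<phi> x = u x" if "x \<in> interior_nodes" for x
    using that by (simp add: w_def cut_def)
  ultimately have "helmholtz_hodge h \<Omega> u w \<phi>"
    unfolding helmholtz_hodge_def zero_off_inner_iff by blast
  then show ?thesis by blast
qed

text \<open>The difference of two decompositions decomposes the zero field, so its solenoidal part
  has norm zero.\<close>

lemma helmholtz_hodge_unique:
  assumes "helmholtz_hodge h \<Omega> u w \<phi>" "helmholtz_hodge h \<Omega> u w' \<phi>'"
  shows "w = w'"
proof -
  define d \<psi> where "d = (\<lambda>x. w x - w' x)" and "\<psi> = (\<lambda>x. \<phi> x - \<phi>' x)"
  have "grid_div h d x = grid_div h w x - grid_div h w' x" for x
    by (simp add: d_def grid_div_def D_minus_def algebra_simps sum_subtractf sum.distrib)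
  moreover have "grid_grad h \<psi> x = grid_grad h \<phi> x - grid_grad h \<phi>' x" for x
    by (simp add: \<psi>_def grid_grad_def D_plus_def vec_eq_iff algebra_simps)
  moreover have "d x + grid_grad h \<psi> x = 0" if "x \<in> interior_nodes" for x
  proof -
    have "w x + grid_grad h \<phi> x = w' x + grid_grad h \<phi>' x"
      using assms that by (simp add: helmholtz_hodge_def)
    then show ?thesis using calculation(2)[of x] by (simp add: d_def) (simp add: algebra_simps)
  qed
  ultimately have hh: "helmholtz_hodge h \<Omega> (\<lambda>_. 0) d \<psi>"
    using assms by (auto simp: helmholtz_hodge_def grid_funs_def d_def \<psi>_def)
  have "grid_inner h \<Omega> (\<lambda>_. 0) d = 0" by (simp add: grid_inner_def)
  then have "(\<Sum>x\<in>nodes. (norm (d x))\<^sup>2 * h ^ 3) = 0"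
    using grid_inner_helmholtz_hodge[OF hh] by (simp add: grid_norm_sq_sum)
  then have "\<forall>x\<in>nodes. (norm (d x))\<^sup>2 * h ^ 3 = 0"
    using h_pos by (subst (asm) sum_nonneg_eq_0_iff[OF finite_nodes]) auto
  then have "d x = 0" for x
    using h_pos hh by (cases "x \<in> nodes") (auto simp: helmholtz_hodge_def grid_funs_def)
  then show ?thesis by (auto simp: d_def)
qed

text \<open>Justifies the definite description in \<open>P_h\<close>; all properties of the
  projection are read off from here.\<close>

lemma P_h_helmholtz_hodge: "\<exists>\<phi>. helmholtz_hodge h \<Omega> u (P_h h \<Omega> u) \<phi>"
proof -
  have "\<exists>!w. \<exists>\<phi>. helmholtz_hodge h \<Omega> u w \<phi>"
    using helmholtz_hodge_exists helmholtz_hodge_unique by blast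
  then show ?thesis unfolding P_h_def by (rule theI')
qed

lemma P_h_solenoidal:
  shows "x \<notin> nodes \<Longrightarrow> P_h h \<Omega> u x = 0" "x \<in> interior_nodes \<Longrightarrow> grid_div h (P_h h \<Omega> u) x = 0"
  using P_h_helmholtz_hodge[of u] unfolding helmholtz_hodge_def grid_funs_def by blast+

lemma grid_norm_P_h: "grid_norm h \<Omega> (P_h h \<Omega> u) \<le> grid_norm h \<Omega> u"
  using P_h_helmholtz_hodge grid_norm_helmholtz_hodge by blast

end

section \<open>Cell averages\<close>

text \<open>Cauchy-Schwarz against the constant 1, from the nonnegative quadratic polynomial
  \<integral>(norm (g x) - t)^2 in t.\<close>

lemma norm_integral_sq_le:
  fixes g :: "'a \<Rightarrow> 'b::{banach, second_countable_topology}"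
  assumes "finite_measure M" and sq: "integrable M (\<lambda>x. (norm (g x))\<^sup>2)"
  shows "(norm (\<integral>x. g x \<partial>M))\<^sup>2 \<le> measure M (space M) * (\<integral>x. (norm (g x))\<^sup>2 \<partial>M)"
proof (cases "integrable M g")
  \<comment> \<open>The integral of a non-integrable function is 0 by convention.\<close>
  case False
  then show ?thesis by (simp add: not_integrable_integral_eq)
next
  case True
  interpret finite_measure M by fact
  define m where "m = measure M (space M)"
  define a where "a = (\<integral>x. norm (g x) \<partial>M)"
  define b where "b = (\<integral>x. (norm (g x))\<^sup>2 \<partial>M)"
  have ng: "integrable M (\<lambda>x. norm (g x))" using True by (rule integrable_norm)
  have le: "norm (\<integral>x. g x \<partial>M) \<le> a" unfolding a_def by (rule integral_norm_bound)
  have quad: "0 \<le> b - 2 * t * a + t\<^sup>2 * m" for t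
  proof -
    have "0 \<le> (\<integral>x. (norm (g x) - t)\<^sup>2 \<partial>M)" by (intro integral_nonneg_AE) auto
    also have "\<dots> = (\<integral>x. (norm (g x))\<^sup>2 - 2 * t * norm (g x) + t\<^sup>2 \<partial>M)"
      by (simp add: power2_diff algebra_simps)
    also have "\<dots> = b - 2 * t * a + t\<^sup>2 * m"
      using ng sq by (simp add: a_def b_def m_def)
    finally show ?thesis .
  qed
  have "a\<^sup>2 \<le> m * b"
  proof (cases "m = 0")
    case True
    then have "emeasure M (space M) = 0" by (simp add: m_def emeasure_eq_measure)
    then have "AE x in M. norm (g x) = 0" by (intro AE_I[of _ _ "space M"]) auto
    then have "a = (\<integral>x. 0 \<partial>M)" unfolding a_def using ng by (intro integral_cong_AE) auto
    then show ?thesis using True by simp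
  next
    case False
    then have "m > 0" by (simp add: m_def zero_less_measure_iff)
    then have "m * (b - 2 * (a / m) * a + (a / m)\<^sup>2 * m) = m * b - a\<^sup>2"
      by (simp add: field_simps power2_eq_square)
    \<comment> \<open>The choice t = a / m is the minimum of the quadratic polynomial.\<close>
    then show ?thesis using quad[of "a / m"] \<open>m > 0\<close>
      by (metis diff_ge_0_iff_ge mult_nonneg_nonneg less_imp_le)
  qed
  moreover have "(norm (\<integral>x. g x \<partial>M))\<^sup>2 \<le> a\<^sup>2" using le by (intro power_mono) auto
  ultimately show ?thesis by (simp add: m_def b_def)
qed

section \<open>Measure and disjointness of the grid cubes\<close>

lemma cube_bounds:
  "box (x - (h / 2) *\<^sub>R 1) (x + (h / 2) *\<^sub>R 1) \<subseteq> cube h x"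
  "cube h x \<subseteq> cbox (x - (h / 2) *\<^sub>R 1) (x + (h / 2) *\<^sub>R 1)"
  by (auto simp: cube_def mem_box_cart less_imp_le)

lemma cube_in_lebesgue: "cube h x \<in> sets lebesgue"
proof -
  have "cube h x = (\<Inter>i. {y. x $ i - h / 2 \<le> y $ i} \<inter> {y. y $ i < x $ i + h / 2})"
    by (auto simp: cube_def)
  moreover have "{y::vec3. x $ i - h / 2 \<le> y $ i} \<inter> {y. y $ i < x $ i + h / 2} \<in> sets borel" for i
    by (intro sets.Int borel_closed borel_open closed_halfspace_component_ge_cart
        open_halfspace_component_lt_cart)
  ultimately have "cube h x \<in> sets borel" by auto
  then show ?thesis by (simp add: sets_completionI_sets)
qed

text \<open>The half-open cube lies between an open and a closed box of the same volume.\<close>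

lemma measure_cube:
  assumes "h \<ge> 0"
  shows "cube h x \<in> lmeasurable" "measure lebesgue (cube h x) = h ^ 3"
proof -
  let ?a = "x - (h / 2) *\<^sub>R 1" and ?b = "x + (h / 2) *\<^sub>R 1"
  show lm: "cube h x \<in> lmeasurable"
    using bounded_subset[OF bounded_cbox cube_bounds(2)] cube_in_lebesgue
    by (rule bounded_set_imp_lmeasurable)
  have "measure lebesgue (cbox ?a ?b) = (\<Prod>i\<in>UNIV. ?b $ i - ?a $ i)"
    using assms by (simp add: content_cbox_cart interval_ne_empty_cart)
  also have "\<dots> = h ^ 3" by simp
  finally have c: "measure lebesgue (cbox ?a ?b) = h ^ 3" .
  have "measure lebesgue (cube h x) \<le> measure lebesgue (cbox ?a ?b)"
    using cube_bounds(2) lm by (intro measure_mono_fmeasurable) auto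
  moreover have "measure lebesgue (box ?a ?b) \<le> measure lebesgue (cube h x)"
    using cube_bounds(1) lm by (intro measure_mono_fmeasurable) auto
  moreover have "measure lebesgue (box ?a ?b) = measure lebesgue (cbox ?a ?b)"
    by (simp add: measure_lborel_box_eq measure_lborel_cbox_eq)
  ultimately show "measure lebesgue (cube h x) = h ^ 3" using c by simp
qed

text \<open>At a common point the half-open bounds give strict inequalities: in each coordinate the
  two integer multipliers differ by less than 1.\<close>

lemma disjoint_grid_cubes:
  assumes "h > 0"
  shows "disjoint_family_on (cube h) (grid h)"
  unfolding disjoint_family_on_def
proof safe
  fix x x' y assume x: "x \<in> grid h" "x' \<in> grid h" "x \<noteq> x'" and y: "y \<in> cube h x" "y \<in> cube h x'"
  have "x $ i = x' $ i" for i
  proof -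
    obtain z z' :: int where z: "x $ i = h * of_int z" "x' $ i = h * of_int z'"
      using x unfolding grid_def by blast
    have "x $ i - h / 2 \<le> y $ i" "y $ i < x $ i + h / 2" "x' $ i - h / 2 \<le> y $ i" "y $ i < x' $ i + h / 2"
      using y by (auto simp: cube_def)
    then have "h * of_int z < h * of_int z' + h" "h * of_int z' < h * of_int z + h"
      unfolding z by linarith+
    then have "h * of_int z < h * of_int (z' + 1)" "h * of_int z' < h * of_int (z + 1)"
      by (simp_all add: algebra_simps)
    then have "z < z' + 1" "z' < z + 1" using assms by (simp_all only: mult_less_cancel_left_pos of_int_less_iff)
    then show ?thesis using z by simp
  qed
  with x show "y \<in> {}" by (simp add: vec_eq_iff)
qed

section \<open>Bounds of the averaged data\<close>

context mesh
begin

lemma cube_subset: "x \<in> nodes \<Longrightarrow> cube h x \<subseteq> \<Omega>"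
proof -
  have "cube h x \<subseteq> cube (4 * h) x"
  proof
    fix y assume "y \<in> cube h x"
    then have "x $ i - h / 2 \<le> y $ i" "y $ i < x $ i + h / 2" for i by (auto simp: cube_def)
    then show "y \<in> cube (4 * h) x" using h_pos unfolding cube_def by (smt (verit) field_sum_of_halves mem_Collect_eq)
  qed
  then show "x \<in> nodes \<Longrightarrow> cube h x \<subseteq> \<Omega>" by (auto simp: grid_dom_def)
qed

text \<open>Cauchy-Schwarz on each cube contributes the factor \<open>h ^ 3\<close>; the remaining
  integrals add up to at most the integral over \<Omega>, as the cubes are disjoint and contained in
  \<Omega>.\<close>

lemma sum_cube_integrals_le:
  assumes \<Omega>: "\<Omega> \<in> sets lebesgue" and v: "v \<in> L2 \<Omega>"
  shows "(\<Sum>x\<in>nodes. (norm (\<integral>y. v y \<partial>lebesgue_on (cube h x)))\<^sup>2) \<le> h ^ 3 * (L2_norm \<Omega> v)\<^sup>2"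
proof -
  let ?q = "\<lambda>y. (norm (v y))\<^sup>2"
  have int\<Omega>: "integrable lebesgue (\<lambda>y. indicator \<Omega> y *\<^sub>R ?q y)"
    using v \<Omega> by (simp add: L2_def integrable_restrict_space)
  have cube_int: "integrable lebesgue (\<lambda>y. indicator (cube h x) y *\<^sub>R ?q y)" if "x \<in> nodes" for x
  proof -
    have "integrable lebesgue (\<lambda>y. indicator (cube h x) y *\<^sub>R (indicator \<Omega> y *\<^sub>R ?q y))"
      by (rule integrable_mult_indicator[OF cube_in_lebesgue int\<Omega>])
    moreover have "(\<lambda>y. indicator (cube h x) y *\<^sub>R (indicator \<Omega> y *\<^sub>R ?q y)) =
        (\<lambda>y. indicator (cube h x) y *\<^sub>R ?q y)"
      using cube_subset[OF that] by (auto simp: indicator_def fun_eq_iff)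
    ultimately show ?thesis by (simp only:)
  qed
  have cs: "(norm (\<integral>y. v y \<partial>lebesgue_on (cube h x)))\<^sup>2 \<le> h ^ 3 * (\<integral>y. indicator (cube h x) y *\<^sub>R ?q y \<partial>lebesgue)"
    if x: "x \<in> nodes" for x
  proof -
    have "finite_measure (lebesgue_on (cube h x))"
      using measure_cube(1)[of h x] h_pos by (intro finite_measure_lebesgue_on) auto
    moreover have "integrable (lebesgue_on (cube h x)) ?q"
      using cube_int[OF x] cube_in_lebesgue by (simp add: integrable_restrict_space)
    ultimately have "(norm (\<integral>y. v y \<partial>lebesgue_on (cube h x)))\<^sup>2 \<le>
        measure (lebesgue_on (cube h x)) (space (lebesgue_on (cube h x))) * (\<integral>y. ?q y \<partial>lebesgue_on (cube h x))"
      by (rule norm_integral_sq_le)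
    moreover have "measure (lebesgue_on (cube h x)) (space (lebesgue_on (cube h x))) = h ^ 3"
      using measure_cube(2)[of h x] h_pos cube_in_lebesgue[of h x] by (simp add: measure_restrict_space)
    moreover have "(\<integral>y. ?q y \<partial>lebesgue_on (cube h x)) = (\<integral>y. indicator (cube h x) y *\<^sub>R ?q y \<partial>lebesgue)"
      using cube_in_lebesgue by (simp add: integral_restrict_space)
    ultimately show ?thesis by simp
  qed
  have "(\<Sum>x\<in>nodes. (norm (\<integral>y. v y \<partial>lebesgue_on (cube h x)))\<^sup>2) \<le>
      h ^ 3 * (\<Sum>x\<in>nodes. \<integral>y. indicator (cube h x) y *\<^sub>R ?q y \<partial>lebesgue)"
    unfolding sum_distrib_left by (intro sum_mono cs)
  also have "(\<Sum>x\<in>nodes. \<integral>y. indicator (cube h x) y *\<^sub>R ?q y \<partial>lebesgue) =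
      (\<integral>y. (\<Sum>x\<in>nodes. indicator (cube h x) y *\<^sub>R ?q y) \<partial>lebesgue)"
    using cube_int by (intro Bochner_Integration.integral_sum[symmetric]) auto
  also have "\<dots> \<le> (\<integral>y. indicator \<Omega> y *\<^sub>R ?q y \<partial>lebesgue)"
  proof (intro integral_mono int\<Omega> Bochner_Integration.integrable_sum cube_int)
    fix y
    have "disjoint_family_on (cube h) nodes"
      using disjoint_grid_cubes[OF h_pos] by (rule disjoint_family_on_mono[rotated]) (auto simp: grid_dom_def)
    \<comment> \<open>Disjointness makes the sum of indicators the indicator of the union.\<close>
    then have "(\<Sum>x\<in>nodes. indicator (cube h x) y :: real) = indicator (\<Union>x\<in>nodes. cube h x) y"
      by (simp add: indicator_UN_disjoint[OF finite_nodes])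
    also have "\<dots> \<le> indicator \<Omega> y"
      using cube_subset by (intro indicator_leI) auto
    finally show "(\<Sum>x\<in>nodes. indicator (cube h x) y *\<^sub>R ?q y) \<le> indicator \<Omega> y *\<^sub>R ?q y"
      unfolding scaleR_left.sum[symmetric] by (intro scaleR_right_mono) auto
  qed
  also have "\<dots> = (L2_norm \<Omega> v)\<^sup>2"
    using \<Omega> by (simp add: L2_norm_def integral_restrict_space integral_nonneg_AE)
  finally show ?thesis using h_pos by simp
qed

lemma grid_norm_init_avg_le:
  assumes "\<Omega> \<in> sets lebesgue" "v \<in> L2 \<Omega>"
  shows "grid_norm h \<Omega> (init_avg h \<Omega> v) \<le> L2_norm \<Omega> v"
proof (rule power2_le_imp_le)
  let ?c = "\<lambda>x. (norm (\<integral>y. v y \<partial>lebesgue_on (cube h x)))\<^sup>2"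
  have "(grid_norm h \<Omega> (init_avg h \<Omega> v))\<^sup>2 \<le> (\<Sum>x\<in>nodes. ?c x / h ^ 3)"
    unfolding grid_norm_sq_sum
  proof (rule sum_mono)
    fix x
    \<comment> \<open>With k = \<open>h ^ 3\<close>: the squared average times the cell volume
      leaves 1/k, which cancels the factor in \<open>sum_cube_integrals_le\<close>.\<close>
    have "(norm ((\<integral>y. v y \<partial>lebesgue_on (cube h x)) /\<^sub>R k))\<^sup>2 * k = ?c x / k" if "k > 0" for k
      using that by (simp add: power_mult_distrib divide_simps power2_eq_square)
    from this[of "h ^ 3"] show "(norm (init_avg h \<Omega> v x))\<^sup>2 * h ^ 3 \<le> ?c x / h ^ 3"
      using h_pos by (auto simp: init_avg_def)
  qed
  also have "\<dots> = (\<Sum>x\<in>nodes. ?c x) / h ^ 3" by (simp add: sum_divide_distrib)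
  also have "\<dots> \<le> (L2_norm \<Omega> v)\<^sup>2"
    using sum_cube_integrals_le[OF assms] h_pos by (simp add: divide_simps mult.commute)
  finally show "(grid_norm h \<Omega> (init_avg h \<Omega> v))\<^sup>2 \<le> (L2_norm \<Omega> v)\<^sup>2" .
qed (simp add: L2_norm_def integral_nonneg_AE)

text \<open>Time integrals of non-integrable functions are \<open>0\<close>, so \<open>G\<close> below makes strong measurability
  of \<open>f\<close> superfluous.\<close>

lemma grid_norm_force_avg_sq_le:
  assumes \<Omega>: "\<Omega> \<in> sets lebesgue" and f: "f \<in> L2_loc_time \<Omega>" and \<tau>: "\<tau> > 0"
  shows "(grid_norm h \<Omega> (force_avg h \<tau> \<Omega> f n))\<^sup>2 * \<tau> \<le>
    (\<integral>t. (L2_norm \<Omega> (f t))\<^sup>2 \<partial>lebesgue_on {\<tau> * real n .. \<tau> * (real n + 1)})"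
proof -
  let ?I = "{\<tau> * real n .. \<tau> * (real n + 1)}"
  let ?M = "lebesgue_on ?I"
  let ?\<phi> = "\<lambda>t. (L2_norm \<Omega> (f t))\<^sup>2"
  define g where "g x t = (\<integral>y. f t y \<partial>lebesgue_on (cube h x))" for x t
  define G where "G x t = (if integrable ?M (g x) then g x t else 0)" for x t
  have I0: "?I \<subseteq> {0..}"
  proof
    fix t assume "t \<in> ?I"
    moreover have "0 \<le> \<tau> * real n" using \<tau> by simp
    ultimately show "t \<in> {0..}" unfolding atLeast_iff atLeastAtMost_iff by linarith
  qed
  then have IR: "?I \<subseteq> {0..\<tau> * (real n + 1)}" by auto
  have G_int: "(\<integral>t. G x t \<partial>?M) = (\<integral>t. g x t \<partial>?M)" for x
    by (cases "integrable ?M (g x)") (simp_all add: G_def[abs_def] not_integrable_integral_eq)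
  have \<phi>: "integrable ?M ?\<phi>"
  proof -
    have "integrable (lebesgue_on {0..\<tau> * (real n + 1)}) ?\<phi>"
      using f \<tau> by (simp add: L2_loc_time_def)
    then show ?thesis by (rule integrable_subinterval) (use IR in auto)
  qed
  have "AE t in lebesgue. t \<in> {0..} \<longrightarrow> f t \<in> L2 \<Omega>"
    using f by (simp add: L2_loc_time_def AE_restrict_space_iff)
  then have "AE t in ?M. f t \<in> L2 \<Omega>"
    using I0 by (auto simp: AE_restrict_space_iff elim!: eventually_mono)
  then have ae: "AE t in ?M. (\<Sum>x\<in>nodes. (norm (G x t))\<^sup>2) \<le> h ^ 3 * ?\<phi> t"
  proof (rule eventually_mono)
    fix t assume "f t \<in> L2 \<Omega>"
    have "(\<Sum>x\<in>nodes. (norm (G x t))\<^sup>2) \<le> (\<Sum>x\<in>nodes. (norm (g x t))\<^sup>2)"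
      by (intro sum_mono) (simp add: G_def)
    also have "\<dots> \<le> h ^ 3 * ?\<phi> t"
      unfolding g_def by (rule sum_cube_integrals_le[OF \<Omega> \<open>f t \<in> L2 \<Omega>\<close>])
    finally show "(\<Sum>x\<in>nodes. (norm (G x t))\<^sup>2) \<le> h ^ 3 * ?\<phi> t" .
  qed
  \<comment> \<open>One summand is dominated by the whole sum, which \<open>ae\<close> bounds by an
    integrable function of time.\<close>
  have G_sq: "integrable ?M (\<lambda>t. (norm (G x t))\<^sup>2)" if x: "x \<in> nodes" for x
  proof (rule Bochner_Integration.integrable_bound)
    show "integrable ?M (\<lambda>t. h ^ 3 * ?\<phi> t)" using \<phi> by simp
    have "integrable ?M (G x)"
      by (cases "integrable ?M (g x)") (simp_all add: G_def[abs_def])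
    then have "G x \<in> borel_measurable ?M" by (rule borel_measurable_integrable)
    then show "(\<lambda>t. (norm (G x t))\<^sup>2) \<in> borel_measurable ?M" by measurable
    show "AE t in ?M. norm ((norm (G x t))\<^sup>2) \<le> norm (h ^ 3 * ?\<phi> t)"
      using ae
    proof (rule eventually_mono)
      fix t assume le: "(\<Sum>x\<in>nodes. (norm (G x t))\<^sup>2) \<le> h ^ 3 * ?\<phi> t"
      have "(norm (G x t))\<^sup>2 \<le> (\<Sum>x\<in>nodes. (norm (G x t))\<^sup>2)"
        using x by (intro member_le_sum finite_nodes) auto
      with le show "norm ((norm (G x t))\<^sup>2) \<le> norm (h ^ 3 * ?\<phi> t)" using h_pos by simp
    qed
  qed
  have fin: "finite_measure ?M" by (intro finite_measure_lebesgue_on) auto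
  have len: "measure ?M (space ?M) = \<tau>"
    using \<tau> by (simp add: measure_restrict_space algebra_simps)
  \<comment> \<open>Cauchy-Schwarz in time on a window of length \<tau>; the spatial bound
    \<open>ae\<close> is applied afterwards under the time integral.\<close>
  have "(\<Sum>x\<in>nodes. (norm (\<integral>t. g x t \<partial>?M))\<^sup>2) \<le> (\<Sum>x\<in>nodes. \<tau> * (\<integral>t. (norm (G x t))\<^sup>2 \<partial>?M))"
    using norm_integral_sq_le[OF fin G_sq] by (intro sum_mono) (simp only: len G_int)
  also have "\<dots> = \<tau> * (\<integral>t. (\<Sum>x\<in>nodes. (norm (G x t))\<^sup>2) \<partial>?M)"
    using G_sq by (simp add: sum_distrib_left)
  also have "\<dots> \<le> \<tau> * (\<integral>t. h ^ 3 * ?\<phi> t \<partial>?M)"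
    using \<tau> \<phi> ae G_sq by (intro mult_left_mono integral_mono_AE Bochner_Integration.integrable_sum) auto
  finally have le: "(\<Sum>x\<in>nodes. (norm (\<integral>t. g x t \<partial>?M))\<^sup>2) \<le> \<tau> * h ^ 3 * (\<integral>t. ?\<phi> t \<partial>?M)"
    by simp
  have "(grid_norm h \<Omega> (force_avg h \<tau> \<Omega> f n))\<^sup>2 =
      (\<Sum>x\<in>nodes. (norm (\<integral>t. g x t \<partial>?M))\<^sup>2 / (\<tau>\<^sup>2 * h ^ 3))"
    unfolding grid_norm_sq_sum
  proof (rule sum.cong[OF refl])
    fix x assume "x \<in> nodes"
    then have "force_avg h \<tau> \<Omega> f n x = (\<integral>t. g x t \<partial>?M) /\<^sub>R (\<tau> * h ^ 3)"
      by (simp add: force_avg_def g_def)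
    then show "(norm (force_avg h \<tau> \<Omega> f n x))\<^sup>2 * h ^ 3 = (norm (\<integral>t. g x t \<partial>?M))\<^sup>2 / (\<tau>\<^sup>2 * h ^ 3)"
      using h_pos \<tau> by (simp add: power_mult_distrib divide_simps power2_eq_square)
  qed
  also have "\<dots> = (\<Sum>x\<in>nodes. (norm (\<integral>t. g x t \<partial>?M))\<^sup>2) / (\<tau>\<^sup>2 * h ^ 3)"
    by (simp add: sum_divide_distrib)
  also have "\<dots> \<le> (\<tau> * h ^ 3 * (\<integral>t. ?\<phi> t \<partial>?M)) / (\<tau>\<^sup>2 * h ^ 3)"
    using le h_pos by (intro divide_right_mono) auto
  also have "\<dots> = (\<integral>t. ?\<phi> t \<partial>?M) / \<tau>"
    using h_pos \<tau> by (simp add: power2_eq_square)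
  finally show ?thesis using \<tau> by (simp add: field_simps)
qed

text \<open>Cauchy-Schwarz over the \<open>N\<close> steps produces the factor
  \<open>\<tau> * real N \<le> T\<close>. The windows tile \<open>{0..\<tau> * real N}\<close>, so
  the squared bounds add up to at most the integral over \<open>{0..T}\<close>.\<close>

lemma sum_grid_norm_force_avg_le:
  assumes \<Omega>: "\<Omega> \<in> sets lebesgue" and f: "f \<in> L2_loc_time \<Omega>" and \<tau>: "\<tau> > 0"
    and T: "\<tau> * real N \<le> T" "T > 0"
  shows "(\<Sum>m=0..<N. grid_norm h \<Omega> (force_avg h \<tau> \<Omega> f m) * \<tau>) \<le> sqrt T * L2_time_norm T \<Omega> f"
proof -
  let ?\<phi> = "\<lambda>t. (L2_norm \<Omega> (f t))\<^sup>2"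
  let ?F = "\<lambda>m. grid_norm h \<Omega> (force_avg h \<tau> \<Omega> f m)"
  have leb: "integrable (lebesgue_on {a..b}) ?\<phi>" if "0 \<le> a" "b \<le> T" for a b
  proof -
    have "integrable (lebesgue_on {0..T}) ?\<phi>" using f T by (simp add: L2_loc_time_def)
    then show ?thesis by (rule integrable_subinterval) (use that in auto)
  qed
  \<comment> \<open>Passage to the gauge integral, which is additive over adjacent closed intervals
    and monotone in the interval here.\<close>
  have hk: "?\<phi> integrable_on {a..b}" "(\<integral>t. ?\<phi> t \<partial>lebesgue_on {a..b}) = integral {a..b} ?\<phi>"
    if "0 \<le> a" "b \<le> T" for a b
    using leb[OF that] by (auto intro: integrable_on_lebesgue_on lebesgue_integral_eq_integral)
  have step: "(\<Sum>m=0..<k. (?F m)\<^sup>2 * \<tau>) \<le> integral {0..\<tau> * real k} ?\<phi>" if "k \<le> N" for k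
    using that
  proof (induction k)
    case (Suc k)
    have "\<tau> * (real k + 1) \<le> \<tau> * real N" using Suc.prems \<tau> by (intro mult_left_mono) auto
    then have kT: "\<tau> * (real k + 1) \<le> T" using T by linarith
    have k0: "0 \<le> \<tau> * real k" "\<tau> * real k \<le> \<tau> * (real k + 1)" using \<tau> by auto
    have "(?F k)\<^sup>2 * \<tau> \<le> integral {\<tau> * real k..\<tau> * (real k + 1)} ?\<phi>"
      using grid_norm_force_avg_sq_le[OF \<Omega> f \<tau>, of k] hk(2)[OF k0(1) kT] by simp
    moreover have "(\<Sum>m=0..<k. (?F m)\<^sup>2 * \<tau>) \<le> integral {0..\<tau> * real k} ?\<phi>"
      using Suc by simp
    moreover have "integral {0..\<tau> * real k} ?\<phi> + integral {\<tau> * real k..\<tau> * (real k + 1)} ?\<phi> =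
        integral {0..\<tau> * (real k + 1)} ?\<phi>"
      using k0 hk(1)[OF order_refl kT] by (rule Henstock_Kurzweil_Integration.integral_combine)
    ultimately show ?case by (simp add: add.commute)
  qed simp
  have "(\<Sum>m=0..<N. ?F m * \<tau>)\<^sup>2 \<le> (\<Sum>m=0..<N. (?F m * \<tau>)\<^sup>2) * real (card {0..<N})"
    by (rule sum_squared_le_sum_of_squares) 
  also have "\<dots> = \<tau> * real N * (\<Sum>m=0..<N. (?F m)\<^sup>2 * \<tau>)"
    by (simp add: sum_distrib_left sum_distrib_right power2_eq_square ac_simps)
  also have "\<dots> \<le> T * integral {0..\<tau> * real N} ?\<phi>"
    using T \<tau> by (intro mult_mono step sum_nonneg) auto
  also have "\<dots> \<le> T * integral {0..T} ?\<phi>"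
    using T \<tau> hk(1)[of 0] by (intro mult_left_mono integral_subset_le) auto
  also have "\<dots> = (sqrt T * L2_time_norm T \<Omega> f)\<^sup>2"
  proof -
    have "0 \<le> (\<integral>t. ?\<phi> t \<partial>lebesgue_on {0..T})" by (intro integral_nonneg_AE) auto
    then show ?thesis
      using T by (simp add: L2_time_norm_def power_mult_distrib hk(2)[of 0 T, symmetric])
  qed
  finally show ?thesis
  proof (rule power2_le_imp_le)
    show "0 \<le> sqrt T * L2_time_norm T \<Omega> f"
      unfolding L2_time_norm_def using T
      by (intro mult_nonneg_nonneg real_sqrt_ge_zero integral_nonneg_AE) auto
  qed
qed

section \<open>The discrete problem\<close>

text \<open>The recurrence is run explicitly. Every \<open>U n\<close> is a value of
  \<open>P_h\<close>, hence discretely divergence free, and so each half step is uniquely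
  solvable.\<close>

lemma discrete_solution_ex1:
  assumes \<tau>: "\<tau> > 0"
  shows "\<exists>!p. discrete_solution h \<tau> \<Omega> v0 f N (fst p) (snd p)"
proof -
  define Q where "Q n u w \<longleftrightarrow> (\<forall>x. x \<notin> interior_nodes \<longrightarrow> w x = 0) \<and>
    momentum_eq h \<tau> \<Omega> u w (force_avg h \<tau> \<Omega> f n)" for n u w
  define W where "W n u = (THE w. Q n u w)" for n u
  define U where "U = rec_nat (P_h h \<Omega> (init_avg h \<Omega> v0)) (\<lambda>n u. P_h h \<Omega> (W n u))"
  have U_0: "U 0 = P_h h \<Omega> (init_avg h \<Omega> v0)" and U_Suc: "U (Suc n) = P_h h \<Omega> (W n (U n))" for n
    by (simp_all add: U_def)
  have U_P: "\<exists>v. U n = P_h h \<Omega> v" for n by (cases n) (auto simp: U_0 U_Suc)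
  have ex1: "\<exists>!w. Q n (U n) w" for n
  proof -
    obtain v where v: "U n = P_h h \<Omega> v" using U_P by blast
    show ?thesis unfolding Q_def v by (rule momentum_eq_unique_solution[OF P_h_solenoidal \<tau>])
  qed
  then have Q_W: "Q n (U n) (W n (U n))" for n unfolding W_def by (rule theI')
  have W_mesh: "W n (U n) \<in> grid_funs h \<Omega>" "\<forall>x\<in>grid_boundary h nodes. W n (U n) x = 0" for n
    using Q_W[of n] unfolding Q_def zero_off_inner_iff by blast+
  have U_mesh: "U n \<in> grid_funs h \<Omega>" for n
    using P_h_solenoidal(1) by (cases n) (auto simp: U_0 U_Suc grid_funs_def)
  \<comment> \<open>Restriction makes both sequences extensional, as
    \<open>discrete_solution\<close> demands beyond \<open>N\<close>. The half step is taken at n =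
    N too, the projection only for n < N.\<close>
  let ?p = "(restrict U {0..N}, restrict (\<lambda>n. W n (U n)) {0..N})"
  show ?thesis
  proof (rule ex1I[of _ ?p])
    show "discrete_solution h \<tau> \<Omega> v0 f N (fst ?p) (snd ?p)"
      using W_mesh U_mesh Q_W unfolding discrete_solution_def Q_def by (auto simp: U_0 U_Suc)
  next
    fix p :: "(nat \<Rightarrow> vec3 \<Rightarrow> vec3) \<times> (nat \<Rightarrow> vec3 \<Rightarrow> vec3)"
    obtain u uh where p: "p = (u, uh)" by (cases p)
    assume "discrete_solution h \<tau> \<Omega> v0 f N (fst p) (snd p)"
    then have sol: "u \<in> {0..N} \<rightarrow>\<^sub>E grid_funs h \<Omega>" "uh \<in> {0..N} \<rightarrow>\<^sub>E grid_funs h \<Omega>"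
      "u 0 = P_h h \<Omega> (init_avg h \<Omega> v0)"
      "\<And>n. n \<le> N \<Longrightarrow> momentum_eq h \<tau> \<Omega> (u n) (uh n) (force_avg h \<tau> \<Omega> f n)"
      "\<And>n. n \<le> N \<Longrightarrow> \<forall>x\<in>grid_boundary h nodes. uh n x = 0"
      "\<And>n. n < N \<Longrightarrow> u (Suc n) = P_h h \<Omega> (uh n)"
      unfolding discrete_solution_def p by auto
    have uh: "uh n = W n (u n)" if "u n = U n" "n \<le> N" for n
    proof -
      have "uh n \<in> grid_funs h \<Omega>" using sol(2) that by auto
      then have "Q n (U n) (uh n)"
        unfolding Q_def zero_off_inner_iff using sol(4,5)[OF that(2)] that(1) by simp
      then show ?thesis unfolding W_def that(1) by (rule the1_equality[OF ex1, symmetric])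
    qed
    \<comment> \<open>Induction alternates between the two substeps: \<open>u n\<close> determines
      \<open>uh n\<close> by unique solvability, and \<open>uh n\<close> determines the next
      \<open>u\<close> through \<open>P_h\<close>.\<close>
    have u: "n \<le> N \<Longrightarrow> u n = U n" for n
      by (induction n) (simp_all add: sol(3,6) U_0 U_Suc uh)
    have "u = restrict U {0..N}"
      using u U_mesh by (intro PiE_ext[OF sol(1)]) auto
    moreover have "uh = restrict (\<lambda>n. W n (U n)) {0..N}"
      using u uh W_mesh by (intro PiE_ext[OF sol(2)]) auto
    ultimately show "p = ?p" by (simp add: p)
  qed
qed

text \<open>One step combines the energy estimate of the half step with the contraction property of
  \<open>P_h\<close>; the second and third bounds then follow by induction on
  \<open>n\<close>.\<close>

lemma discrete_solution_estimates:
  assumes sol: "discrete_solution h \<tau> \<Omega> v0 f N u uh" and \<tau>: "\<tau> > 0"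
  defines "F \<equiv> \<lambda>m. grid_norm h \<Omega> (force_avg h \<tau> \<Omega> f m)"
  shows "n \<le> N \<Longrightarrow> grid_norm h \<Omega> (uh n) \<le> grid_norm h \<Omega> (u n) + F n * \<tau>"
    and "n \<le> N \<Longrightarrow> grid_norm h \<Omega> (u n) \<le> grid_norm h \<Omega> (u 0) + (\<Sum>m=0..<n. F m * \<tau>)"
    and "n < N \<Longrightarrow> (grid_norm h \<Omega> (u (n + 1)))\<^sup>2 \<le> (grid_norm h \<Omega> (u 0))\<^sup>2
      - (\<Sum>m=0..n. (\<Sum>j\<in>UNIV. (grid_norm h \<Omega> (D_plus h j (uh m)))\<^sup>2) * \<tau>)
      + 2 * (\<Sum>m=0..n. grid_norm h \<Omega> (u m) * F m * \<tau>) + (\<Sum>m=0..n. (F m)\<^sup>2 * \<tau>\<^sup>2)"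
proof -
  have u_Suc: "u (Suc n) = P_h h \<Omega> (uh n)" if "n < N" for n
    using sol that by (simp add: discrete_solution_def)
  have u_P: "\<exists>v. u n = P_h h \<Omega> v" if "n \<le> N" for n
    using sol u_Suc that by (cases n) (auto simp: discrete_solution_def)
  have u: "x \<notin> nodes \<Longrightarrow> u n x = 0" "x \<in> interior_nodes \<Longrightarrow> grid_div h (u n) x = 0" if "n \<le> N" for n x
    using u_P[OF that] P_h_solenoidal by auto
  have uh: "momentum_eq h \<tau> \<Omega> (u n) (uh n) (force_avg h \<tau> \<Omega> f n)" if "n \<le> N" for n
    using sol that by (simp add: discrete_solution_def)
  have uh0: "\<forall>x. x \<notin> interior_nodes \<longrightarrow> uh n x = 0" if "n \<le> N" for n
    using sol that unfolding zero_off_inner_iff discrete_solution_def by auto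
  show est1: "grid_norm h \<Omega> (uh n) \<le> grid_norm h \<Omega> (u n) + F n * \<tau>" if "n \<le> N" for n
    unfolding F_def using u uh uh0 that by (intro energy_estimate(1) \<tau>) auto
  have est2: "(grid_norm h \<Omega> (uh n))\<^sup>2 + (\<Sum>j\<in>UNIV. (grid_norm h \<Omega> (D_plus h j (uh n)))\<^sup>2) * \<tau> \<le>
      (grid_norm h \<Omega> (u n) + F n * \<tau>)\<^sup>2" if "n \<le> N" for n
    unfolding F_def using u uh uh0 that by (intro energy_estimate(2) \<tau>) auto
  have proj: "grid_norm h \<Omega> (u (Suc n)) \<le> grid_norm h \<Omega> (uh n)" if "n < N" for n
    using u_Suc[OF that] grid_norm_P_h by simp
  show "grid_norm h \<Omega> (u n) \<le> grid_norm h \<Omega> (u 0) + (\<Sum>m=0..<n. F m * \<tau>)" if "n \<le> N" for n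
    using that
  proof (induction n)
    case (Suc n)
    then show ?case using proj[of n] est1[of n] by simp
  qed simp
  have step: "(grid_norm h \<Omega> (u (Suc n)))\<^sup>2 \<le> (grid_norm h \<Omega> (u n))\<^sup>2
      - (\<Sum>j\<in>UNIV. (grid_norm h \<Omega> (D_plus h j (uh n)))\<^sup>2) * \<tau>
      + 2 * (grid_norm h \<Omega> (u n) * F n * \<tau>) + (F n)\<^sup>2 * \<tau>\<^sup>2" if "n < N" for n
  proof -
    have "(grid_norm h \<Omega> (u (Suc n)))\<^sup>2 \<le> (grid_norm h \<Omega> (uh n))\<^sup>2"
      using proj[OF that] by (intro power_mono grid_norm_nonneg)
    \<comment> \<open>Expanding the square produces the mixed term and the quadratic force term of
      the energy bound.\<close>
    moreover have "(grid_norm h \<Omega> (u n) + F n * \<tau>)\<^sup>2 =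
        (grid_norm h \<Omega> (u n))\<^sup>2 + 2 * (grid_norm h \<Omega> (u n) * F n * \<tau>) + (F n)\<^sup>2 * \<tau>\<^sup>2"
      by (simp add: power2_sum power_mult_distrib)
    ultimately show ?thesis using est2[of n] that by linarith
  qed
  show "(grid_norm h \<Omega> (u (n + 1)))\<^sup>2 \<le> (grid_norm h \<Omega> (u 0))\<^sup>2
      - (\<Sum>m=0..n. (\<Sum>j\<in>UNIV. (grid_norm h \<Omega> (D_plus h j (uh m)))\<^sup>2) * \<tau>)
      + 2 * (\<Sum>m=0..n. grid_norm h \<Omega> (u m) * F m * \<tau>) + (\<Sum>m=0..n. (F m)\<^sup>2 * \<tau>\<^sup>2)"
    if "n < N" for n
    using that
  proof (induction n)
    case 0
    then show ?case using step[of 0] by simp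
  next
    case (Suc n)
    then show ?case using step[of "Suc n"] by (simp add: distrib_left)
  qed
qed

end

theorem theorem4p1:
  fixes \<Omega> :: "(real^3) set"
    and v0 :: "real^3 \<Rightarrow> real^3"
    and f :: "real \<Rightarrow> real^3 \<Rightarrow> real^3"
    and T h \<tau> :: real
    and N :: nat
  assumes "open \<Omega>" and "connected \<Omega>" and "bounded \<Omega>" and "lipschitz_boundary \<Omega>"
    and "T > 0" and "h > 0" and "\<tau> > 0"
    and "v0 \<in> L2_sigma \<Omega>"
    and "f \<in> L2_loc_time \<Omega>"
    and "T \<in> {\<tau> * real N ..< \<tau> * real N + \<tau>}"
  shows "(\<exists>!p. discrete_solution h \<tau> \<Omega> v0 f N (fst p) (snd p)) \<and>
    (\<forall>u uh. discrete_solution h \<tau> \<Omega> v0 f N u uh \<longrightarrow>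
      (\<forall>n<N.
         grid_norm h \<Omega> (uh n) \<le> grid_norm h \<Omega> (u n) + grid_norm h \<Omega> (force_avg h \<tau> \<Omega> f n) * \<tau> \<and>
         grid_norm h \<Omega> (u (n + 1))
           \<le> grid_norm h \<Omega> (u 0) + (\<Sum>m=0..<N. grid_norm h \<Omega> (force_avg h \<tau> \<Omega> f m) * \<tau>) \<and>
         grid_norm h \<Omega> (u 0) + (\<Sum>m=0..<N. grid_norm h \<Omega> (force_avg h \<tau> \<Omega> f m) * \<tau>)
           \<le> L2_norm \<Omega> v0 + sqrt T * L2_time_norm T \<Omega> f \<and>
         (grid_norm h \<Omega> (u (n + 1)))\<^sup>2
           \<le> (grid_norm h \<Omega> (u 0))\<^sup>2
             - (\<Sum>m=0..n. (\<Sum>j\<in>UNIV. (grid_norm h \<Omega> (D_plus h j (uh m)))\<^sup>2) * \<tau>)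
             + 2 * (\<Sum>m=0..n. grid_norm h \<Omega> (u m) * grid_norm h \<Omega> (force_avg h \<tau> \<Omega> f m) * \<tau>)
             + (\<Sum>m=0..n. (grid_norm h \<Omega> (force_avg h \<tau> \<Omega> f m))\<^sup>2 * \<tau>\<^sup>2)))"
proof -
  interpret mesh h \<Omega> using assms by unfold_locales
  have \<Omega>: "\<Omega> \<in> sets lebesgue" using \<open>open \<Omega>\<close> by (simp add: borel_open sets_completionI_sets)
  let ?F = "\<lambda>m. grid_norm h \<Omega> (force_avg h \<tau> \<Omega> f m) * \<tau>"
  have v0: "v0 \<in> L2 \<Omega>" using \<open>v0 \<in> L2_sigma \<Omega>\<close> by (simp add: L2_sigma_def)
  have forces: "(\<Sum>m=0..<N. ?F m) \<le> sqrt T * L2_time_norm T \<Omega> f"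
    using assms by (intro sum_grid_norm_force_avg_le \<Omega>) auto
  \<comment> \<open>The step estimate involves forces up to index \<open>n\<close> only; nonnegative
    terms allow the sum to be extended to all indices below \<open>N\<close>.\<close>
  have mono: "(\<Sum>m=0..<n + 1. ?F m) \<le> (\<Sum>m=0..<N. ?F m)" if "n < N" for n
    using that \<open>\<tau> > 0\<close> by (intro sum_mono2) (auto simp: grid_norm_nonneg)
  \<comment> \<open>Neither cell averaging nor the projection increases the norm.\<close>
  have u0: "grid_norm h \<Omega> (u 0) \<le> L2_norm \<Omega> v0" if "discrete_solution h \<tau> \<Omega> v0 f N u uh" for u uh
  proof -
    have "u 0 = P_h h \<Omega> (init_avg h \<Omega> v0)" using that by (simp add: discrete_solution_def)
    then show ?thesis
      using grid_norm_P_h[of "init_avg h \<Omega> v0"] grid_norm_init_avg_le[OF \<Omega> v0] by simp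
  qed
  show ?thesis
  proof (intro conjI allI impI discrete_solution_ex1 \<open>\<tau> > 0\<close>)
    fix u uh n assume sol: "discrete_solution h \<tau> \<Omega> v0 f N u uh" and n: "n < N"
    note est = discrete_solution_estimates[OF sol \<open>\<tau> > 0\<close>]
    show "grid_norm h \<Omega> (uh n) \<le> grid_norm h \<Omega> (u n) + ?F n" using est(1)[of n] n by simp
    show "grid_norm h \<Omega> (u (n + 1)) \<le> grid_norm h \<Omega> (u 0) + (\<Sum>m=0..<N. ?F m)"
      using est(2)[of "n + 1"] mono[OF n] n by simp
    show "grid_norm h \<Omega> (u 0) + (\<Sum>m=0..<N. ?F m) \<le> L2_norm \<Omega> v0 + sqrt T * L2_time_norm T \<Omega> f"
      using u0[OF sol] forces by (rule add_mono)
  qed (rule discrete_solution_estimates(3)[OF _ \<open>\<tau> > 0\<close>])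
qed

end
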